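(* Let $\mathbf{k}$ be a field of arbitrary characteristic, let $n \ge 2$ be an integer, and let $h(X) \in \mathbf{k}[X]$ with $h(0) \neq 0$ and $\deg_X(h(X)) < n$. Let $R = \mathbf{k}[X,Y,Z]/(X^nY - Z^2 - h(X)Z)$ and let $x \in R$ denote the coset of $X$. Then $\mathrm{AK}(R) = \mathbf{k}[x]$.
   Context: All rings are commutative with identity. Let $A$ be a $\mathbf{k}$-algebra. An exponential map on $A$ is a $\mathbf{k}$-algebra homomorphism $\varphi = \varphi_U : A \to A[U]$ ($U$ an indeterminate) such that (i) $\varepsilon_0\varphi_U$ is the identity on $A$, where $\varepsilon_0 : A[U] \to A$ is evaluation at $U=0$; and (ii) $\varphi_S\varphi_U = \varphi_{S+U}$, where $\varphi_S$ is extended by $\varphi_S(U)=U$ to a homomorphism $A[U] \to A[S,U]$. The ring of $\varphi$-invariants is $A^{\varphi} = \{a \in A : \varphi(a) = a\}$. The AK invariant of $A$ is $\mathrm{AK}(A) = \bigcap_{\varphi} A^{\varphi}$, the intersection over all exponential maps $\varphi$ on $A$. *)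

theory Defs
  imports
    "HOL-Algebra.UnivPoly"
    "HOL-Algebra.QuotRing"
    "HOL-Algebra.Finite_Extensions"
    "HOL-Algebra.Algebraic_Closure_Type"
begin

section \<open>Exponential maps and the AK invariant\<close>

text \<open>
  A \<open>K\<close>-algebra is a commutative ring \<open>A\<close> with a structure homomorphism \<open>\<iota> : K \<rightarrow> A\<close>,
  i.e. \<open>ring_hom_cring K A \<iota>\<close>. The definitions below are meant for this situation.
\<close>

definition UP_const :: "('a, 'm) ring_scheme \<Rightarrow> 'a \<Rightarrow> nat \<Rightarrow> 'a"
  where "UP_const A a = up_ring.monom (UP A) a 0"

definition UP_var :: "('a, 'm) ring_scheme \<Rightarrow> nat \<Rightarrow> 'a"
  where "UP_var A = up_ring.monom (UP A) \<one>\<^bsub>A\<^esub> 1"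

text \<open>
  \<open>A[S,U]\<close> is realised as \<open>A[S][U] = UP (UP A)\<close>, so that \<open>S\<close> is \<open>UP_const (UP A) (UP_var A)\<close> and
  \<open>U\<close> is \<open>UP_var (UP A)\<close>. All homomorphisms out of a polynomial ring \<open>A[U]\<close> are given by
  \<^const>\<open>eval\<close>: \<open>eval A B f s\<close> is the extension of \<open>f : A \<rightarrow> B\<close> with \<open>U \<mapsto> s\<close>.
\<close>

definition extend_exp ::
  "('a, 'm) ring_scheme \<Rightarrow> ('a \<Rightarrow> nat \<Rightarrow> 'a) \<Rightarrow> (nat \<Rightarrow> 'a) \<Rightarrow> nat \<Rightarrow> nat \<Rightarrow> 'a"
  where "extend_exp A \<phi> = eval A (UP (UP A)) (UP_const (UP A) \<circ> \<phi>) (UP_var (UP A))"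

definition exp_at_sum ::
  "('a, 'm) ring_scheme \<Rightarrow> ('a \<Rightarrow> nat \<Rightarrow> 'a) \<Rightarrow> 'a \<Rightarrow> nat \<Rightarrow> nat \<Rightarrow> 'a"
  where "exp_at_sum A \<phi> a =
    eval A (UP (UP A)) (UP_const (UP A) \<circ> UP_const A)
      (UP_const (UP A) (UP_var A) \<oplus>\<^bsub>UP (UP A)\<^esub> UP_var (UP A)) (\<phi> a)"

text \<open>
  The second conjunct is \<open>K\<close>-linearity. Values of \<open>\<phi>\<close> outside the carrier of \<open>A\<close> are irrelevant.
\<close>

definition exponential_map ::
  "('k, 'l) ring_scheme \<Rightarrow> ('a, 'm) ring_scheme \<Rightarrow> ('k \<Rightarrow> 'a) \<Rightarrow> ('a \<Rightarrow> nat \<Rightarrow> 'a) \<Rightarrow> bool"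
  where "exponential_map K A \<iota> \<phi> \<longleftrightarrow>
    \<phi> \<in> ring_hom A (UP A) \<and>
    (\<forall>c\<in>carrier K. \<phi> (\<iota> c) = UP_const A (\<iota> c)) \<and>
    (\<forall>a\<in>carrier A. eval A A (\<lambda>b. b) \<zero>\<^bsub>A\<^esub> (\<phi> a) = a) \<and>
    (\<forall>a\<in>carrier A. extend_exp A \<phi> (\<phi> a) = exp_at_sum A \<phi> a)"

definition exp_invariants :: "('a, 'm) ring_scheme \<Rightarrow> ('a \<Rightarrow> nat \<Rightarrow> 'a) \<Rightarrow> 'a set"
  where "exp_invariants A \<phi> = {a \<in> carrier A. \<phi> a = UP_const A a}"

definition AK :: "('k, 'l) ring_scheme \<Rightarrow> ('a, 'm) ring_scheme \<Rightarrow> ('k \<Rightarrow> 'a) \<Rightarrow> 'a set"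
  where "AK K A \<iota> = (\<Inter>\<phi>\<in>{\<phi>. exponential_map K A \<iota> \<phi>}. exp_invariants A \<phi>)"

text \<open>
  The inclusion \<open>A \<rightarrow> A[U]\<close> is an exponential map, so the intersection in \<^const>\<open>AK\<close> is never
  over the empty family.
\<close>

lemma exponential_map_UP_const:
  assumes "ring_hom_cring K A \<iota>"
  shows "exponential_map K A \<iota> (UP_const A)"
proof -
  have A: "cring A"
    using assms by (rule ring_hom_cring.axioms(2))
  have PA: "cring (UP A)"
    by (rule UP_cring.UP_cring[OF UP_cring.intro[OF A]])
  have PPA: "cring (UP (UP A))"
    by (rule UP_cring.UP_cring[OF UP_cring.intro[OF PA]])
  have UPr: "UP_ring A" "UP_ring (UP A)"
    by (rule UP_ring.intro[OF cring.axioms(1)[OF A]], rule UP_ring.intro[OF cring.axioms(1)[OF PA]])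
  have c: "UP_const A \<in> ring_hom A (UP A)"
    unfolding UP_const_def[abs_def] by (rule UP_ring.const_ring_hom[OF UPr(1)])
  have cc: "UP_const (UP A) \<in> ring_hom (UP A) (UP (UP A))"
    unfolding UP_const_def[abs_def] by (rule UP_ring.const_ring_hom[OF UPr(2)])
  have var: "UP_var (UP A) \<in> carrier (UP (UP A))" "UP_var A \<in> carrier (UP A)"
    unfolding UP_var_def
    by (rule UP_ring.monom_closed[OF UPr(2) ring.ring_simprules(6)[OF cring.axioms(1)[OF PA]]],
        rule UP_ring.monom_closed[OF UPr(1) ring.ring_simprules(6)[OF cring.axioms(1)[OF A]]])
  have sum: "UP_const (UP A) (UP_var A) \<oplus>\<^bsub>UP (UP A)\<^esub> UP_var (UP A) \<in> carrier (UP (UP A))"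
    by (rule ring.ring_simprules(1)[OF cring.axioms(1)[OF PPA] ring_hom_closed[OF cc var(2)] var(1)])
  have Ev: "eval A A (\<lambda>b. b) \<zero>\<^bsub>A\<^esub> (UP_const A a) = a" if "a \<in> carrier A" for a
    unfolding UP_const_def
    by (rule UP_pre_univ_prop.eval_const[OF UP_pre_univ_propI[OF A A]])
      (use that ring.ring_simprules(2)[OF cring.axioms(1)[OF A]] in \<open>simp_all add: ring_hom_def\<close>)
  have Fv: "eval A (UP (UP A)) (UP_const (UP A) \<circ> UP_const A) s (UP_const A a) =
      (UP_const (UP A) \<circ> UP_const A) a"
    if "a \<in> carrier A" "s \<in> carrier (UP (UP A))" for a s
    using UP_pre_univ_prop.eval_const
      [OF UP_pre_univ_propI[OF A PPA ring_hom_trans[OF c cc]] that(2,1)]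
    unfolding UP_const_def .
  show ?thesis
    unfolding exponential_map_def extend_exp_def exp_at_sum_def
  proof (intro conjI ballI)
    fix a assume a: "a \<in> carrier A"
    show "eval A (UP (UP A)) (UP_const (UP A) \<circ> UP_const A) (UP_var (UP A)) (UP_const A a) =
      eval A (UP (UP A)) (UP_const (UP A) \<circ> UP_const A)
        (UP_const (UP A) (UP_var A) \<oplus>\<^bsub>UP (UP A)\<^esub> UP_var (UP A)) (UP_const A a)"
      using Fv[OF a var(1)] Fv[OF a sum] by simp
  qed (rule c refl Ev, assumption?)+
qed


section \<open>The ring \<open>k[X,Y,Z]/(X\<^sup>nY - Z\<^sup>2 - h(X)Z)\<close>\<close>

text \<open>
  \<open>k[X,Y,Z]\<close> is the type \<open>'k poly poly poly\<close>, read as \<open>k[X][Y][Z]\<close>; elements of \<open>k[X]\<close> are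
  embedded as \<open>[:[:p:]:]\<close>.
\<close>

abbreviation polyXYZ :: "'k::field poly poly poly ring"
  where "polyXYZ \<equiv> ring_of_type_algebra"

definition varX :: "'k::field poly poly poly" where "varX = [:[:[:0, 1:]:]:]"

definition varY :: "'k::field poly poly poly" where "varY = [:[:0, 1:]:]"

definition varZ :: "'k::field poly poly poly" where "varZ = [:0, 1:]"

definition rel_ideal :: "nat \<Rightarrow> 'k::field poly \<Rightarrow> 'k poly poly poly set"
  where "rel_ideal n h =
    PIdl\<^bsub>polyXYZ\<^esub> (varX ^ n * varY - varZ ^ 2 - [:[:h:]:] * varZ)"

definition surfR :: "nat \<Rightarrow> 'k::field poly \<Rightarrow> 'k poly poly poly set ring"
  where "surfR n h = polyXYZ Quot rel_ideal n h"

definition surfR_coset :: "nat \<Rightarrow> 'k::field poly \<Rightarrow> 'k poly poly poly \<Rightarrow> 'k poly poly poly set"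
  where "surfR_coset n h p = rel_ideal n h +>\<^bsub>polyXYZ\<^esub> p"

definition surfR_const :: "nat \<Rightarrow> 'k::field poly \<Rightarrow> 'k \<Rightarrow> 'k poly poly poly set"
  where "surfR_const n h c = surfR_coset n h [:[:[:c:]:]:]"

definition surfR_x :: "nat \<Rightarrow> 'k::field poly \<Rightarrow> 'k poly poly poly set"
  where "surfR_x n h = surfR_coset n h varX"

lemma surfR_algebra:
  "ring_hom_cring (ring_of_type_algebra :: 'k::field ring) (surfR n h) (surfR_const n h)"
proof -
  interpret P: cring "polyXYZ :: 'k poly poly poly ring" by (rule cring_from_type_algebra)
  have I: "ideal (rel_ideal n h) polyXYZ"
    unfolding rel_ideal_def
    by (rule P.cgenideal_ideal) (simp add: ring_of_type_algebra_def)
  have K: "cring (ring_of_type_algebra :: 'k ring)" by (rule cring_from_type_algebra)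
  have hom: "(\<lambda>c. [:[:[:c:]:]:]) \<in> ring_hom (ring_of_type_algebra :: 'k ring) polyXYZ"
    by (rule ring_hom_memI) (simp_all add: ring_of_type_algebra_def one_pCons)
  have "(+>\<^bsub>polyXYZ\<^esub>) (rel_ideal n h) \<in> ring_hom polyXYZ (surfR n h)"
    unfolding surfR_def by (rule ideal.rcos_ring_hom[OF I])
  from ring_hom_trans[OF hom this]
  have "surfR_const n h \<in> ring_hom ring_of_type_algebra (surfR n h)"
    unfolding comp_def surfR_const_def[abs_def] surfR_coset_def .
  moreover have "cring (surfR n h)"
    unfolding surfR_def by (rule ideal.quotient_is_cring[OF I P.is_cring])
  ultimately show ?thesis
    using K by (intro ring_hom_cring.intro ring_hom_cring_axioms.intro)
qed

end

theory Submission
  imports Defs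
begin

text \<open>
  Write \<open>R\<close> for the surface ring and \<open>x, y, z\<close> for the classes of the variables.  Inverting \<open>x\<close> makes
  \<open>y = x\<^sup>-\<^sup>n z (z + h(x))\<close> redundant, so \<open>R\<close> embeds in \<open>k(x)[z]\<close> and inherits its \<open>z\<close>-degree, with
  \<open>deg x = 0\<close>, \<open>deg y = 2\<close>, \<open>deg z = 1\<close>.  Since \<open>z\<^sup>2\<close> is a combination of \<open>x\<^sup>n y\<close> and \<open>z\<close>, every nonzero
  \<open>a \<in> R\<close> has a leading term \<open>q(x) y\<^sup>b z\<^sup>e\<close> with \<open>e \<in> {0, 1}\<close> and \<open>deg a = 2b + e\<close> (\<open>leading_term\<close>).

  Only \<open>k[x]\<close> survives: \<open>z \<mapsto> z + x\<^sup>n U\<close>, \<open>x \<mapsto> x\<close> extends to an exponential map of \<open>R\<close>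
  (\<open>shift_map_exponential\<close>), and it turns the \<open>z\<close>-degree of an element into its \<open>U\<close>-degree.  Hence its
  invariants have \<open>z\<close>-degree zero, and by the leading term they lie in \<open>k[x]\<close>.

  Conversely, every exponential map \<open>\<phi>\<close> fixes \<open>x\<close> (\<open>D_xx\<close>).  Write \<open>\<phi>(a) = \<Sum> D\<^sub>i(a) U\<^sup>i\<close>.  The \<open>D\<^sub>i\<close>
  obey the Leibniz rule, and the group law reads \<open>D\<^sub>i D\<^sub>j = (i+j choose i) D\<^sub>i\<^sub>+\<^sub>j\<close>.  Suppose that \<open>D\<^sub>i g\<close> is
  nonzero for some \<open>i \<ge> 1\<close> and some generator \<open>g = x, y, z\<close>, and let \<open>\<mu>\<close> be the largest slope
  \<open>(deg D\<^sub>i g - deg g) / i\<close> over all such pairs.  Then \<open>deg D\<^sub>i a \<le> deg a + i \<mu>\<close> for all \<open>a\<close>.  Let \<open>e(a)\<close>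
  be the last \<open>i\<close> for which equality holds; it is the \<open>U\<close>-degree of the leading form of \<open>\<phi>(a)\<close> when
  \<open>U\<close> has weight \<open>-\<mu>\<close>.  The function \<open>e\<close> is additive on products and depends only on the leading
  term, so with \<open>N = e(x)\<close>, \<open>L = e(y)\<close>, \<open>M = e(z)\<close> the equation of the surface gives
  \<open>n N + L = 2 M\<close>.  These three numbers are not all zero, whence \<open>M > 0\<close>.

  The group law implies \<open>e(D\<^sub>m a) = 0\<close> for \<open>m = e(a)\<close>.  So the leading term of \<open>D\<^sub>M z\<close>, whose degree is
  \<open>1 + M \<mu>\<close>, contains no \<open>z\<close>.  If \<open>L > 0\<close> it contains no \<open>y\<close> either, so \<open>1 + M \<mu> = 0\<close> and \<open>\<mu> < 0\<close>.
  As \<open>deg D\<^sub>i x \<le> i \<mu> < 0\<close>, this forces \<open>D\<^sub>i x = 0\<close> for \<open>i \<ge> 1\<close>, which is the claim.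

  The case \<open>L = 0\<close>, \<open>n N = 2 M\<close> is impossible, and this is where \<open>n \<ge> 2\<close> enters.  The degrees \<open>N \<mu>\<close> of
  \<open>D\<^sub>N x\<close> and \<open>1 + M \<mu>\<close> of \<open>D\<^sub>M z\<close> are both even, which makes \<open>n\<close> odd, hence \<open>n \<ge> 3\<close>, \<open>N\<close> even and
  \<open>M > N\<close>.  All values of \<open>e\<close> have the form \<open>N d + M e'\<close>, so none lies strictly between \<open>0\<close> and \<open>N\<close>.  But \<open>D\<^sub>N\<^sub>-\<^sub>j x\<close> and \<open>D\<^sub>M\<^sub>-\<^sub>j z\<close> would
  have the value \<open>j\<close> unless the binomial coefficients \<open>(N choose j)\<close> and \<open>(M choose j)\<close> vanish in \<open>k\<close> for
  \<open>0 < j < N\<close>.  For even \<open>N\<close> the first vanishing gives \<open>2 = 0\<close> in \<open>k\<close>, and the two together give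
  \<open>n = (nN choose N) = (2M choose N) = 2 (M choose N) = 0\<close> in \<open>k\<close>, contradicting that \<open>n\<close> is odd.
\<close>

section \<open>The surface ring inside \<open>k(x)[z]\<close>\<close>

text \<open>
  The embedding of \<open>k[X][Y][Z]\<close> is built one variable at a time; this is the step that carries
  additivity and multiplicativity from one stage to the next.
\<close>

lemma poly_map_poly_ring_hom:
  fixes f :: "'a::comm_ring_1 \<Rightarrow> 'b::comm_ring_1"
  assumes "f 0 = 0" and add: "\<And>a b. f (a + b) = f a + f b" and mult: "\<And>a b. f (a * b) = f a * f b"
  shows "poly (map_poly f (p + q)) s = poly (map_poly f p) s + poly (map_poly f q) s"
    and "poly (map_poly f (p * q)) s = poly (map_poly f p) s * poly (map_poly f q) s"
proof -
  have sum: "f (sum g S) = (\<Sum>i\<in>S. f (g i))" for g :: "nat \<Rightarrow> 'a" and S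
    by (induction S rule: infinite_finite_induct) (simp_all add: assms)
  have "map_poly f (p + q) = map_poly f p + map_poly f q"
    by (rule poly_eqI) (simp add: coeff_map_poly assms)
  then show "poly (map_poly f (p + q)) s = poly (map_poly f p) s + poly (map_poly f q) s"
    by simp
  have "map_poly f (p * q) = map_poly f p * map_poly f q"
    by (rule poly_eqI) (simp add: coeff_map_poly coeff_mult sum assms)
  then show "poly (map_poly f (p * q)) s = poly (map_poly f p) s * poly (map_poly f q) s"
    by simp
qed

locale danielewski =
  fixes n :: nat and h :: "'k::field poly"
begin

definition base :: "'k poly \<Rightarrow> 'k poly fract poly"
  where "base q = [:to_fract q:]"

definition xx :: "'k poly fract poly" where "xx = base [:0, 1:]"

definition zz :: "'k poly fract poly" where "zz = [:0, 1:]"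

definition yy :: "'k poly fract poly"
  where "yy = smult (inverse (to_fract [:0, 1:] ^ n)) (zz ^ 2 + base h * zz)"

definition embXY :: "'k poly poly \<Rightarrow> 'k poly fract poly"
  where "embXY f = poly (map_poly base f) yy"

definition emb :: "'k poly poly poly \<Rightarrow> 'k poly fract poly"
  where "emb P = poly (map_poly embXY P) zz"

lemma base_simps [simp]:
  "base 0 = 0" "base 1 = 1" "base (p + q) = base p + base q" "base (p * q) = base p * base q"
  "base (- p) = - base p" "base (p - q) = base p - base q"
  "base p = 0 \<longleftrightarrow> p = 0" "degree (base p) = 0"
  by (simp_all add: base_def flip: one_pCons)

lemma embXY_simps [simp]:
  "embXY 0 = 0" "embXY (f + g) = embXY f + embXY g" "embXY (f * g) = embXY f * embXY g"
  "embXY (pCons q f) = base q + yy * embXY f"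
  by (simp_all add: embXY_def poly_map_poly_ring_hom map_poly_pCons)

lemma emb_simps [simp]:
  "emb 0 = 0" "emb (P + Q) = emb P + emb Q" "emb (P * Q) = emb P * emb Q"
  "emb (pCons f P) = embXY f + zz * emb P"
  by (simp_all add: emb_def poly_map_poly_ring_hom map_poly_pCons)

lemma embXY_1 [simp]: "embXY 1 = 1"
proof -
  have "embXY [:1:] = 1" by simp
  then show ?thesis by (simp flip: one_pCons)
qed

lemma emb_1 [simp]: "emb 1 = 1"
proof -
  have "emb [:1:] = 1" by simp
  then show ?thesis by (simp flip: one_pCons)
qed

lemma emb_diff [simp]: "emb (P - Q) = emb P - emb Q"
  using emb_simps(2)[of "P - Q" Q] by (simp add: algebra_simps)

lemma emb_power [simp]: "emb (P ^ m) = emb P ^ m"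
  by (induction m) simp_all

lemma emb_vars [simp]: "emb varX = xx" "emb varY = yy" "emb varZ = zz"
  by (simp_all add: varX_def varY_def varZ_def xx_def flip: one_pCons)

lemma degree_xx [simp]: "degree xx = 0" and xx_nonzero [simp]: "xx \<noteq> 0"
  by (simp_all add: xx_def)

lemma degree_zz [simp]: "degree zz = 1" and zz_nonzero [simp]: "zz \<noteq> 0"
  by (simp_all add: zz_def)

lemma to_fract_var_nonzero [simp]: "to_fract [:0, 1:] \<noteq> (0 :: 'k poly fract)"
  by (simp only: to_fract_eq_0_iff pCons_eq_0_iff) simp

lemma xx_power: "xx ^ m = [:to_fract [:0, 1:] ^ m:]"
  by (simp add: xx_def base_def poly_const_pow)

lemma surface_relation: "xx ^ n * yy = zz ^ 2 + base h * zz"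
  unfolding yy_def xx_power by simp

lemma degree_yy [simp]: "degree yy = 2" and yy_nonzero [simp]: "yy \<noteq> 0"
proof -
  have "zz ^ 2 + base h * zz = [:0, to_fract h, 1:]"
    by (simp add: zz_def base_def power2_eq_square)
  then show "degree yy = 2" unfolding yy_def by simp
  then show "yy \<noteq> 0" by auto
qed

definition rel :: "'k poly poly poly"
  where "rel = varX ^ n * varY - varZ ^ 2 - [:[:h:]:] * varZ"

lemma emb_rel [simp]: "emb rel = 0"
  by (simp add: rel_def surface_relation del: mult_pCons_left)

text \<open>
  The relation of the surface is, up to sign, monic of degree two in \<open>Z\<close>, so every class has a
  representative that is linear in \<open>Z\<close>.
\<close>

lemma reduce_mod_rel: "\<exists>Q f g. P = rel * Q + [:f, g:]"
proof (induction P)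
  case 0
  show ?case by (rule exI[of _ 0], rule exI[of _ 0], rule exI[of _ 0]) simp
next
  case (pCons c P)
  then obtain Q f g where P: "P = rel * Q + [:f, g:]" by blast
  have xn: "varX ^ n * varY = [:[:[:0, 1:]:] ^ n * [:0, 1:]:]"
    by (simp add: varX_def varY_def poly_const_pow)
  have "pCons c P = [:c:] + varZ * P"
    by (simp add: varZ_def)
  also have "\<dots> = rel * (varZ * Q - [:g:]) +
      ([:c:] + varZ * [:f:] + [:g:] * (varX ^ n * varY - [:[:h:]:] * varZ))"
    unfolding P rel_def by (simp add: varZ_def algebra_simps power2_eq_square)
  also have "[:c:] + varZ * [:f:] + [:g:] * (varX ^ n * varY - [:[:h:]:] * varZ) =
      [:c + g * ([:[:0, 1:]:] ^ n * [:0, 1:]), f - g * [:h:]:]"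
    unfolding xn varZ_def by (simp add: algebra_simps)
  finally show ?case by blast
qed

text \<open>
  \<open>y\<close> has \<open>z\<close>-degree two, so Horner's scheme doubles the degree in \<open>Y\<close>.
\<close>

lemma degree_embXY: "f \<noteq> 0 \<Longrightarrow> embXY f \<noteq> 0 \<and> degree (embXY f) = 2 * degree f"
proof (induction f)
  case (pCons q f)
  show ?case
  proof (cases "f = 0")
    case False
    then have "degree (yy * embXY f) = 2 + 2 * degree f"
      using pCons.IH by (simp add: degree_mult_eq)
    moreover from this have "degree (base q + yy * embXY f) = degree (yy * embXY f)"
      by (intro degree_add_eq_right) simp
    ultimately show ?thesis using False by (auto simp del: degree_0 simp add: degree_0)
  qed (use pCons.hyps in simp)
qed simp

lemma embXY_leading:
  "f \<noteq> 0 \<Longrightarrow> \<exists>r. embXY f = base (lead_coeff f) * yy ^ degree f + r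
    \<and> (r = 0 \<or> degree r < 2 * degree f)"
proof (induction f)
  case (pCons q f)
  show ?case
  proof (cases "f = 0")
    case False
    then obtain r where r: "embXY f = base (lead_coeff f) * yy ^ degree f + r"
      "r = 0 \<or> degree r < 2 * degree f"
      using pCons.IH by blast
    have "degree (yy * r) < 2 * degree (pCons q f)"
      using r(2) False by (cases "r = 0") (auto simp: degree_mult_eq)
    then have "degree (base q + yy * r) < 2 * degree (pCons q f)"
      using False degree_add_le_max[of "base q" "yy * r"] by auto
    then show ?thesis using False
      by (intro exI[of _ "base q + yy * r"]) (auto simp: r(1) algebra_simps)
  qed simp
qed simp

text \<open>
  The two summands of a representative linear in \<open>Z\<close> have degrees of different parity and cannot
  cancel.  This one observation yields both the kernel of \<open>emb\<close> and the leading terms.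
\<close>

lemma emb_linear_eq_0: "emb [:f, g:] = 0 \<longleftrightarrow> f = 0 \<and> g = 0"
proof
  assume "emb [:f, g:] = 0"
  then have eq: "embXY f = - (zz * embXY g)" by (simp add: eq_neg_iff_add_eq_0)
  show "f = 0 \<and> g = 0"
  proof (rule ccontr)
    assume *: "\<not> (f = 0 \<and> g = 0)"
    have "embXY f = 0 \<longleftrightarrow> f = 0" "zz * embXY g = 0 \<longleftrightarrow> g = 0"
      using degree_embXY[of f] degree_embXY[of g] by auto
    with eq * have "f \<noteq> 0" "g \<noteq> 0" by auto
    then have "degree (embXY f) = 2 * degree f" "degree (- (zz * embXY g)) = 1 + 2 * degree g"
      using degree_embXY[of f] degree_embXY[of g] by (auto simp: degree_mult_eq)
    with eq show False by presburger
  qed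
qed simp

lemma emb_eq_0_iff: "emb P = 0 \<longleftrightarrow> rel dvd P"
proof -
  obtain Q f g where P: "P = rel * Q + [:f, g:]" using reduce_mod_rel by blast
  have "emb P = emb [:f, g:]" unfolding P by simp
  then have "emb P = 0 \<longleftrightarrow> [:f, g:] = 0" using emb_linear_eq_0[of f g] by simp
  moreover have "[:f, g:] = 0" if "rel dvd P"
  proof -
    from that have "emb P = 0" by (auto elim!: dvdE)
    with calculation show ?thesis by simp
  qed
  ultimately show ?thesis unfolding P by auto
qed

definition A :: "'k poly fract poly set" where "A = range emb"

lemma A_closed [intro, simp]:
  "a \<in> A \<Longrightarrow> b \<in> A \<Longrightarrow> a + b \<in> A" "a \<in> A \<Longrightarrow> b \<in> A \<Longrightarrow> a * b \<in> A" "a \<in> A \<Longrightarrow> b \<in> A \<Longrightarrow> a - b \<in> A"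
  "0 \<in> A" "1 \<in> A" "xx \<in> A" "yy \<in> A" "zz \<in> A" "base q \<in> A"
proof -
  have im: "emb P \<in> A" for P unfolding A_def by simp
  show "0 \<in> A" "1 \<in> A" "xx \<in> A" "yy \<in> A" "zz \<in> A" "base q \<in> A"
    using im[of 0] im[of 1] im[of varX] im[of varY] im[of varZ] im[of "[:[:q:]:]"] by simp_all
next
  assume "a \<in> A" "b \<in> A"
  then obtain P Q where "a = emb P" "b = emb Q" unfolding A_def by blast
  then have "a + b = emb (P + Q)" "a * b = emb (P * Q)" "a - b = emb (P - Q)" by simp_all
  then show "a + b \<in> A" "a * b \<in> A" "a - b \<in> A" unfolding A_def by blast+
qed

lemma A_power [intro, simp]: "a \<in> A \<Longrightarrow> a ^ m \<in> A"
  by (induction m) auto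

text \<open>
  The pieces of the associated graded ring are free of rank one over \<open>k[x]\<close>, because the degree of \<open>a\<close>
  determines \<open>b\<close> and \<open>e\<close>.
  Properties that depend only on leading terms can therefore be read off from \<open>x\<close>, \<open>y\<close>, \<open>z\<close>.
\<close>

lemma leading_term:
  assumes "a \<in> A" "a \<noteq> 0"
  obtains q b e where "q \<noteq> 0" "e \<in> {0, 1}" "degree a = 2 * b + e"
    "a = base q * yy ^ b * zz ^ e \<or> degree (a - base q * yy ^ b * zz ^ e) < degree a"
proof -
  obtain P where "a = emb P" using assms unfolding A_def by blast
  moreover obtain Q f g where "P = rel * Q + [:f, g:]" using reduce_mod_rel by blast
  ultimately have a: "a = embXY f + zz * embXY g" by simp
  have fg: "f \<noteq> 0 \<or> g \<noteq> 0" using assms a by auto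
  have degf: "f \<noteq> 0 \<Longrightarrow> degree (embXY f) = 2 * degree f" using degree_embXY by blast
  have degg: "g \<noteq> 0 \<Longrightarrow> degree (zz * embXY g) = 2 * degree g + 1"
    using degree_embXY by (auto simp: degree_mult_eq)
  show thesis
  proof (cases "f \<noteq> 0 \<and> (g = 0 \<or> degree g < degree f)")
    case True
    then obtain r where r: "embXY f = base (lead_coeff f) * yy ^ degree f + r"
      "r = 0 \<or> degree r < 2 * degree f" using embXY_leading by blast
    have deg: "degree a = 2 * degree f"
      using True degf degg degree_add_eq_left[of "zz * embXY g" "embXY f"] unfolding a
      by (cases "g = 0") auto
    let ?r = "r + zz * embXY g"
    have "?r = 0 \<or> degree ?r < 2 * degree f"
      using r(2) True degg degree_add_le_max[of r "zz * embXY g"] by (cases "g = 0") auto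
    moreover have "a - base (lead_coeff f) * yy ^ degree f * zz ^ 0 = ?r"
      unfolding a r(1) by simp
    ultimately show thesis
      using True deg by (intro that[of "lead_coeff f" 0 "degree f"]) auto
  next
    case False
    with fg have g: "g \<noteq> 0" "f = 0 \<or> degree f \<le> degree g" by auto
    then obtain r where r: "embXY g = base (lead_coeff g) * yy ^ degree g + r"
      "r = 0 \<or> degree r < 2 * degree g" using embXY_leading by blast
    have deg: "degree a = 2 * degree g + 1"
      unfolding a using g degf degg
      by (cases "f = 0") (auto simp: degree_add_eq_right simp del: degree_mult_eq)
    let ?r = "embXY f + zz * r"
    have "degree (embXY f) < 2 * degree g + 1"
      using g degf by (cases "f = 0") auto
    moreover have "degree (zz * r) < 2 * degree g + 1"
      using r(2) by (cases "r = 0") (auto simp: degree_mult_eq)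
    ultimately have "degree ?r < 2 * degree g + 1"
      using degree_add_le_max[of "embXY f" "zz * r"] by linarith
    moreover have "a - base (lead_coeff g) * yy ^ degree g * zz ^ 1 = ?r"
      unfolding a r(1) by (simp add: algebra_simps)
    ultimately show thesis
      using g deg by (intro that[of "lead_coeff g" 1 "degree g"]) auto
  qed
qed

end

section \<open>Degree bounds with real exponents\<close>

text \<open>
  The zero polynomial satisfies every bound, including negative ones: its degree counts as
  \<open>-\<infinity>\<close> here, although \<^const>\<open>Polynomial.degree\<close> gives it the value \<open>0\<close>.
\<close>

definition deg_le :: "'a::zero poly \<Rightarrow> real \<Rightarrow> bool"
  where "deg_le p r \<longleftrightarrow> p = 0 \<or> real (degree p) \<le> r"

definition deg_less :: "'a::zero poly \<Rightarrow> real \<Rightarrow> bool"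
  where "deg_less p r \<longleftrightarrow> p = 0 \<or> real (degree p) < r"

lemma deg_le_add: "deg_le p r \<Longrightarrow> deg_le q r \<Longrightarrow> deg_le (p + q) r"
  using degree_add_le_max[of p q] unfolding deg_le_def by (auto simp: max_def split: if_splits)

lemma deg_less_add: "deg_less p r \<Longrightarrow> deg_less q r \<Longrightarrow> deg_less (p + q) r"
  using degree_add_le_max[of p q] unfolding deg_less_def by (auto simp: max_def split: if_splits)

lemma deg_le_sum: "(\<And>i. i \<in> S \<Longrightarrow> deg_le (f i) r) \<Longrightarrow> deg_le (sum f S) r"
  by (induction S rule: infinite_finite_induct) (auto intro: deg_le_add simp: deg_le_def[of 0])

lemma deg_less_sum: "(\<And>i. i \<in> S \<Longrightarrow> deg_less (f i) r) \<Longrightarrow> deg_less (sum f S) r"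
  by (induction S rule: infinite_finite_induct) (auto intro: deg_less_add simp: deg_less_def[of 0])

lemma deg_le_mult:
  fixes p q :: "'a::idom poly"
  shows "deg_le p r \<Longrightarrow> deg_le q s \<Longrightarrow> deg_le (p * q) (r + s)"
  unfolding deg_le_def by (cases "p = 0"; cases "q = 0") (auto simp: degree_mult_eq)

lemma deg_less_mult:
  fixes p q :: "'a::idom poly"
  shows "deg_less p r \<and> deg_le q s \<or> deg_le p r \<and> deg_less q s \<Longrightarrow> deg_less (p * q) (r + s)"
  unfolding deg_le_def deg_less_def
  by (cases "p = 0"; cases "q = 0") (auto simp: degree_mult_eq)

lemma deg_le_mono: "deg_le p r \<Longrightarrow> r \<le> s \<Longrightarrow> deg_le p s"
  unfolding deg_le_def by auto

lemma degree_add_deg_less: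
  fixes p q :: "'a::ab_group_add poly"
  assumes "p \<noteq> 0" "deg_less q (degree p)"
  shows "p + q \<noteq> 0" "degree (p + q) = degree p"
proof -
  show "degree (p + q) = degree p"
    using assms degree_add_eq_left[of q p] unfolding deg_less_def by auto
  show "p + q \<noteq> 0"
    using assms by (auto simp: deg_less_def eq_neg_iff_add_eq_0[symmetric])
qed

section \<open>Vanishing binomial coefficients\<close>

text \<open>
  The alternating sum of a row of Pascal's triangle is zero, and for even \<open>N\<close> both ends of the row
  enter it with the sign \<open>+\<close>.
\<close>

lemma choose_middle_zero_char_2:
  fixes N :: nat
  assumes "even N" "N > 0" and zero: "\<And>j. 0 < j \<Longrightarrow> j < N \<Longrightarrow> of_nat (N choose j) = (0 :: 'a::comm_ring_1)"
  shows "(2 :: 'a) = 0"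
proof -
  have "0 = (\<Sum>i\<le>N. (-1) ^ i * of_nat (N choose i) :: 'a)"
    using choose_alternating_sum[OF \<open>N > 0\<close>] by simp
  also have "\<dots> = (\<Sum>i\<in>{0, N}. (-1) ^ i * of_nat (N choose i))"
    by (rule sum.mono_neutral_right) (auto simp: zero le_less)
  also have "\<dots> = 2" using assms by simp
  finally show ?thesis by simp
qed

text \<open>
  Vanishing of the inner coefficients means \<open>(1 + T)\<^sup>N = 1 + T\<^sup>N\<close>, and then the coefficient of \<open>T\<^sup>N\<close> in
  \<open>(1 + T\<^sup>N)\<^sup>k\<close> is \<open>k\<close>.
\<close>

lemma choose_multiple:
  fixes N :: nat
  assumes "N > 0" and zero: "\<And>j. 0 < j \<Longrightarrow> j < N \<Longrightarrow> of_nat (N choose j) = (0 :: 'a::comm_ring_1)"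
  shows "of_nat ((k * N) choose N) = (of_nat k :: 'a)"
proof (induction k)
  case (Suc k)
  have "of_nat (Suc k * N choose N) = (of_nat (\<Sum>j\<le>N. (N choose j) * (k * N choose (N - j))) :: 'a)"
    by (simp only: vandermonde mult_Suc)
  also have "\<dots> = (\<Sum>j\<le>N. of_nat (N choose j) * of_nat (k * N choose (N - j)))"
    by (simp only: of_nat_sum of_nat_mult)
  also have "\<dots> = (\<Sum>j\<in>{0, N}. of_nat (N choose j) * of_nat (k * N choose (N - j)))"
    by (rule sum.mono_neutral_right) (auto simp: zero le_less)
  also have "\<dots> = of_nat (Suc k)" using Suc assms by simp
  finally show ?case .
qed (use assms in \<open>simp add: binomial_eq_0\<close>)

lemma choose_double:
  fixes N :: nat
  assumes "N > 0" and zero: "\<And>j. 0 < j \<Longrightarrow> j < N \<Longrightarrow> of_nat (M choose j) = (0 :: 'a::comm_ring_1)"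
  shows "of_nat ((2 * M) choose N) = (2 * of_nat (M choose N) :: 'a)"
proof -
  have "of_nat (2 * M choose N) = (of_nat (\<Sum>j\<le>N. (M choose j) * (M choose (N - j))) :: 'a)"
    by (simp only: vandermonde mult_2)
  also have "\<dots> = (\<Sum>j\<le>N. of_nat (M choose j) * of_nat (M choose (N - j)))"
    by (simp only: of_nat_sum of_nat_mult)
  also have "\<dots> = (\<Sum>j\<in>{0, N}. of_nat (M choose j) * of_nat (M choose (N - j)))"
    by (rule sum.mono_neutral_right) (auto simp: zero le_less)
  also have "\<dots> = 2 * of_nat (M choose N)" using assms by simp
  finally show ?thesis .
qed

section \<open>The last extremal coefficient of an exponential map\<close>

text \<open>
  \<open>D i a\<close> is the coefficient of \<open>U\<^sup>i\<close> in the image of \<open>a\<close> under an exponential map, read inside \<open>k(x)[z]\<close>.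
  The axiom \<open>D_comp\<close> is the comparison of coefficients in \<open>\<phi>\<^sub>S \<phi>\<^sub>U = \<phi>\<^sub>S\<^sub>+\<^sub>U\<close>.
\<close>

locale danielewski_hasse = danielewski n h for n :: nat and h :: "'k::field poly" +
  fixes D :: "nat \<Rightarrow> 'k poly fract poly \<Rightarrow> 'k poly fract poly"
  assumes n_ge_2: "n \<ge> 2"
    and D_closed [intro, simp]: "a \<in> A \<Longrightarrow> D i a \<in> A"
    and D_add: "a \<in> A \<Longrightarrow> b \<in> A \<Longrightarrow> D i (a + b) = D i a + D i b"
    and D_mult: "a \<in> A \<Longrightarrow> b \<in> A \<Longrightarrow> D m (a * b) = (\<Sum>i\<le>m. D i a * D (m - i) b)"
    and D_0: "a \<in> A \<Longrightarrow> D 0 a = a"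
    and D_const: "i > 0 \<Longrightarrow> D i (base [:c:]) = 0"
    and D_comp: "a \<in> A \<Longrightarrow> D i (D j a) = of_nat ((i + j) choose i) * D (i + j) a"
    and D_finite: "a \<in> A \<Longrightarrow> finite {i. D i a \<noteq> 0}"
begin

lemma D_zero: "D i 0 = 0"
proof -
  have "D i 0 = D i 0 + D i 0"
    using D_add[of 0 0 i] by (simp only: add_0_left A_closed)
  then show ?thesis by (metis add_cancel_right_right)
qed

end

text \<open>
  \<open>\<mu>\<close> bounds the slope with which the \<open>z\<close>-degree grows along the coefficients of the three generators.
  It may be negative.
\<close>

locale weighted_hasse = danielewski_hasse n h D
  for n :: nat and h :: "'k::field poly" and D +
  fixes \<mu> :: real
  assumes weight_xx: "deg_le (D i xx) (i * \<mu>)"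
    and weight_yy: "deg_le (D i yy) (2 + i * \<mu>)"
    and weight_zz: "deg_le (D i zz) (1 + i * \<mu>)"
begin

definition bounded :: "'k poly fract poly \<Rightarrow> real \<Rightarrow> bool"
  where "bounded a r \<longleftrightarrow> a \<in> A \<and> (\<forall>i. deg_le (D i a) (r + i * \<mu>))"

lemma bounded_add: "bounded a r \<Longrightarrow> bounded b r \<Longrightarrow> bounded (a + b) r"
  unfolding bounded_def by (auto simp: D_add intro: deg_le_add)

lemma bounded_mult:
  assumes "bounded a r" "bounded b s"
  shows "bounded (a * b) (r + s)"
  unfolding bounded_def
proof (intro conjI allI)
  fix m
  have "deg_le (D i a * D (m - i) b) (r + s + m * \<mu>)" if "i \<le> m" for i
  proof -
    have "deg_le (D i a * D (m - i) b) ((r + i * \<mu>) + (s + (m - i) * \<mu>))"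
      using assms unfolding bounded_def by (intro deg_le_mult) auto
    also have "(r + i * \<mu>) + (s + (m - i) * \<mu>) = r + s + m * \<mu>"
      using that by (simp add: of_nat_diff algebra_simps)
    finally show ?thesis .
  qed
  then show "deg_le (D m (a * b)) (r + s + m * \<mu>)"
    using assms by (auto simp: bounded_def D_mult intro!: deg_le_sum)
qed (use assms in \<open>auto simp: bounded_def\<close>)

lemma bounded_const: "bounded (base [:c:]) 0"
  unfolding bounded_def
proof (intro conjI allI)
  show "deg_le (D i (base [:c:])) (0 + i * \<mu>)" for i
    by (cases "i = 0") (auto simp: D_0 D_const deg_le_def)
qed simp

lemma base_pCons: "base (pCons c q) = base [:c:] + xx * base q"
proof -
  have "pCons c q = [:c:] + [:0, 1:] * q" by simp
  then show ?thesis unfolding xx_def by (metis base_simps(3,4))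
qed

lemma bounded_base: "bounded (base q) 0"
proof (induction q)
  case 0
  show ?case using bounded_const[of 0] by simp
next
  case (pCons c q)
  have "bounded xx 0" unfolding bounded_def using weight_xx by simp
  from bounded_add[OF bounded_const bounded_mult[OF this pCons.IH, simplified]] show ?case
    by (subst base_pCons) simp
qed

lemma bounded_power: "bounded a r \<Longrightarrow> bounded (a ^ m) (m * r)"
proof (induction m)
  case 0
  then show ?case using bounded_base[of 1] by simp
next
  case (Suc m)
  then show ?case using bounded_mult[of a r "a ^ m" "m * r"] by (simp add: algebra_simps)
qed

text \<open>
  The Leibniz rule propagates the bounds from the generators to monomials.  They reach \<open>a\<close> without
  loss because the leading term has the same degree as \<open>a\<close> and the rest a smaller one.
\<close>

lemma bounded_degree: "a \<in> A \<Longrightarrow> bounded a (degree a)"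
proof (induction "degree a" arbitrary: a rule: less_induct)
  case less
  show ?case
  proof (cases "a = 0")
    case True
    then show ?thesis using bounded_base[of 0] by simp
  next
    case False
    with less.prems obtain q b e where lead: "degree a = 2 * b + e"
      "a = base q * yy ^ b * zz ^ e \<or> degree (a - base q * yy ^ b * zz ^ e) < degree a"
      by (rule leading_term)
    let ?t = "base q * yy ^ b * zz ^ e"
    have "bounded yy 2" "bounded zz 1"
      unfolding bounded_def using weight_yy weight_zz by auto
    then have "bounded ?t (0 + real b * 2 + real e * 1)"
      by (intro bounded_mult bounded_base bounded_power)
    then have t: "bounded ?t (degree a)" by (simp add: lead(1) mult.commute)
    from lead(2) show ?thesis
    proof
      assume "degree (a - ?t) < degree a"
      then have "bounded (a - ?t) (degree (a - ?t))" "real (degree (a - ?t)) \<le> degree a"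
        using less by auto
      then have "bounded (a - ?t) (degree a)"
        unfolding bounded_def by (auto intro: deg_le_mono)
      from bounded_add[OF t this] show ?thesis by simp
    qed (use t in simp)
  qed
qed

lemma weight: "a \<in> A \<Longrightarrow> deg_le (D i a) (degree a + i * \<mu>)"
  using bounded_degree unfolding bounded_def by blast

text \<open>
  Give \<open>U\<close> the weight \<open>-\<mu>\<close>.  Then all coefficients of \<open>\<phi>(a)\<close> have weight at most \<open>deg a\<close>, and \<open>m\<close> is the
  \<open>U\<close>-degree of the part of weight exactly \<open>deg a\<close>, the leading form of \<open>\<phi>(a)\<close>.
\<close>

definition has_udeg :: "'k poly fract poly \<Rightarrow> nat \<Rightarrow> bool"
  where "has_udeg a m \<longleftrightarrow> a \<in> A \<and> D m a \<noteq> 0 \<and> real (degree (D m a)) = degree a + m * \<mu> \<and>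
    (\<forall>i>m. deg_less (D i a) (degree a + i * \<mu>))"

lemma udeg_exists:
  assumes "a \<in> A" "a \<noteq> 0"
  obtains m where "has_udeg a m"
proof -
  let ?S = "{i. D i a \<noteq> 0 \<and> real (degree (D i a)) = degree a + i * \<mu>}"
  have fin: "finite ?S"
    using D_finite[OF assms(1)] by (rule finite_subset[rotated]) auto
  moreover have "0 \<in> ?S" using assms by (simp add: D_0)
  ultimately have "Max ?S \<in> ?S" by (intro Max_in) auto
  moreover have "deg_less (D i a) (degree a + i * \<mu>)" if "i > Max ?S" for i
  proof -
    have "i \<notin> ?S" using that Max_ge[OF fin, of i] by auto
    then show ?thesis using weight[OF assms(1), of i] unfolding deg_le_def deg_less_def by auto
  qed
  ultimately have "has_udeg a (Max ?S)" unfolding has_udeg_def using assms by auto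
  then show thesis by (rule that)
qed

lemma udeg_unique: "has_udeg a m \<Longrightarrow> has_udeg a m' \<Longrightarrow> m = m'"
  unfolding has_udeg_def deg_less_def by (metis linorder_neqE_nat less_irrefl)

lemma udeg_nonzero: "has_udeg a m \<Longrightarrow> a \<noteq> 0"
  unfolding has_udeg_def by (auto simp: D_zero)

text \<open>
  Leading forms multiply.  In terms of coefficients, the term \<open>D l a * D m b\<close> of the Leibniz rule attains the
  maximal degree, and every other term of index at least \<open>l + m\<close> has one factor beyond its last extremal
  index.
\<close>

lemma udeg_mult:
  assumes a: "has_udeg a l" and b: "has_udeg b m"
  shows "has_udeg (a * b) (l + m)"
  unfolding has_udeg_def
proof (intro conjI allI impI)
  have A: "a \<in> A" "b \<in> A" using a b unfolding has_udeg_def by auto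
  then show "a * b \<in> A" by simp
  have deg: "degree (a * b) = degree a + degree b"
    using udeg_nonzero[OF a] udeg_nonzero[OF b] by (rule degree_mult_eq)
  have le: "deg_le (D i a) (degree a + i * \<mu>)" "deg_le (D i b) (degree b + i * \<mu>)" for i
    using A by (auto intro: weight)
  have less: "deg_less (D i a * D (j - i) b) (degree (a * b) + j * \<mu>)"
    if "i \<le> j" "l < i \<or> m < j - i" for i j
  proof -
    have "deg_less (D i a * D (j - i) b)
        ((degree a + i * \<mu>) + (degree b + (j - i) * \<mu>))"
      using that(2) a b le unfolding has_udeg_def by (intro deg_less_mult) blast
    moreover have "(degree a + i * \<mu>) + (degree b + (j - i) * \<mu>) = degree (a * b) + j * \<mu>"
      using that(1) by (simp add: deg of_nat_diff algebra_simps)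
    ultimately show ?thesis by simp
  qed
  show "deg_less (D j (a * b)) (degree (a * b) + j * \<mu>)" if "j > l + m" for j
    unfolding D_mult[OF A] using that by (intro deg_less_sum less) auto
  have "D (l + m) (a * b) = D l a * D m b + (\<Sum>i\<in>{..l + m} - {l}. D i a * D (l + m - i) b)"
    unfolding D_mult[OF A] by (subst sum.remove[of _ l]) auto
  moreover have "deg_less (\<Sum>i\<in>{..l + m} - {l}. D i a * D (l + m - i) b) (degree (a * b) + (l + m) * \<mu>)"
  proof (rule deg_less_sum)
    fix i assume "i \<in> {..l + m} - {l}"
    then have "i \<le> l + m" "l < i \<or> m < l + m - i" by auto
    from less[OF this] show "deg_less (D i a * D (l + m - i) b) (degree (a * b) + (l + m) * \<mu>)"
      by simp
  qed
  moreover have "D l a * D m b \<noteq> 0"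
    "real (degree (D l a * D m b)) = degree (a * b) + (l + m) * \<mu>"
    using a b unfolding has_udeg_def deg by (auto simp: degree_mult_eq algebra_simps)
  ultimately show "D (l + m) (a * b) \<noteq> 0"
    "real (degree (D (l + m) (a * b))) = degree (a * b) + (l + m) * \<mu>"
    using degree_add_deg_less[of "D l a * D m b"] by auto
qed

lemma udeg_power: "has_udeg a m \<Longrightarrow> has_udeg (a ^ k) (k * m)"
proof (induction k)
  case 0
  have "D i (1::'k poly fract poly) = 0" if "i > 0" for i
    using D_const[OF that, of 1] by (simp flip: one_pCons)
  then show ?case unfolding has_udeg_def by (auto simp: D_0 deg_less_def)
next
  case (Suc k)
  then show ?case using udeg_mult[of a m "a ^ k" "k * m"] by simp
qed

lemma udeg_leading:
  assumes t: "has_udeg t m" and A: "a \<in> A" and less: "deg_less (a - t) (degree t)"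
  shows "has_udeg a m"
proof -
  have tA: "t \<in> A" using t unfolding has_udeg_def by simp
  have a: "a = t + (a - t)" by simp
  have deg: "degree a = degree t"
    using degree_add_deg_less(2)[OF udeg_nonzero[OF t] less] by simp
  have D: "D i a = D i t + D i (a - t)" for i
    using D_add[of t "a - t" i] tA A by simp
  have rest: "deg_less (D i (a - t)) (degree t + i * \<mu>)" for i
    using weight[of "a - t" i] less A tA by (auto simp: deg_less_def deg_le_def D_zero)
  show ?thesis
    unfolding has_udeg_def deg D
    using t A rest degree_add_deg_less[of "D m t" "D m (a - t)"] rest[of m]
    unfolding has_udeg_def by (auto intro: deg_less_add)
qed

lemma udeg_base_exists:
  assumes "q \<noteq> 0" obtains m where "has_udeg (base q) m"
  using assms udeg_exists[of "base q"] by auto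

text \<open>
  Horner's scheme adds a constant to \<open>x q'(x)\<close>, which changes only \<open>D 0\<close>.  The hypothesis \<open>N > 0\<close>
  ensures that the last extremal coefficient has positive index.
\<close>

lemma udeg_base:
  assumes x: "has_udeg xx N" and "N > 0"
  shows "q \<noteq> 0 \<Longrightarrow> has_udeg (base q) (N * degree q)"
proof (induction q)
  case (pCons c q)
  show ?case
  proof (cases "q = 0")
    case True
    then show ?thesis using pCons.hyps D_const[of _ c] by (auto simp: has_udeg_def D_0 deg_less_def)
  next
    case False
    with pCons.IH have "has_udeg (base q) (N * degree q)" by simp
    from udeg_mult[OF x this] have xq: "has_udeg (xx * base q) (N * degree (pCons c q))"
      using False by simp
    have "D i (base (pCons c q)) = D i (xx * base q)" if "i > 0" for i
      using that by (subst base_pCons) (simp add: D_add D_const)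
    moreover have "degree (base (pCons c q)) = degree (xx * base q)"
      by (simp add: degree_mult_eq False)
    ultimately show ?thesis
      using xq \<open>N > 0\<close> False unfolding has_udeg_def by (auto simp del: degree_mult_eq)
  qed
qed simp

lemma udeg_decompose:
  assumes x: "has_udeg xx N" and y: "has_udeg yy L" and z: "has_udeg zz M" and a: "has_udeg a m"
  obtains q b e d where "q \<noteq> 0" "e \<in> {0, 1}" "degree a = 2 * b + e" "has_udeg (base q) d"
    "m = d + b * L + e * M"
proof -
  have "a \<in> A" "a \<noteq> 0" using a udeg_nonzero[OF a] unfolding has_udeg_def by auto
  then obtain q b e where lead: "q \<noteq> 0" "e \<in> {0, 1}" "degree a = 2 * b + e"
    "a = base q * yy ^ b * zz ^ e \<or> degree (a - base q * yy ^ b * zz ^ e) < degree a"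
    by (rule leading_term)
  let ?t = "base q * yy ^ b * zz ^ e"
  obtain d where d: "has_udeg (base q) d" using lead(1) by (rule udeg_base_exists)
  have t: "has_udeg ?t (d + b * L + e * M)"
    using udeg_mult[OF udeg_mult[OF d udeg_power[OF y]] udeg_power[OF z]] .
  have "degree ?t = degree a"
    using lead(1,3) by (simp add: degree_mult_eq degree_power_eq mult.commute)
  with lead(4) have "deg_less (a - ?t) (degree ?t)" unfolding deg_less_def by auto
  from udeg_leading[OF t \<open>a \<in> A\<close> this] have "m = d + b * L + e * M"
    using udeg_unique[OF a] by blast
  with lead d show thesis by (intro that)
qed

text \<open>
  \<open>z + h(x)\<close> has the leading term \<open>z\<close>, so the equation \<open>x\<^sup>n y = z (z + h(x))\<close> becomes additive.
\<close>

lemma udeg_relation: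
  assumes x: "has_udeg xx N" and y: "has_udeg yy L" and z: "has_udeg zz M"
  shows "n * N + L = 2 * M"
proof -
  have "deg_less ((zz + base h) - zz) (degree zz)" by (simp add: deg_less_def)
  from udeg_leading[OF z _ this] have "has_udeg (zz + base h) M" by simp
  from udeg_mult[OF z this] have "has_udeg (zz ^ 2 + base h * zz) (M + M)"
    by (simp add: power2_eq_square algebra_simps)
  moreover have "has_udeg (xx ^ n * yy) (n * N + L)"
    by (intro udeg_mult udeg_power x y)
  ultimately show ?thesis
    unfolding surface_relation using udeg_unique by fastforce
qed

text \<open>
  By the group law, \<open>D i\<close> of \<open>D (m - j) a\<close> is a multiple of \<open>D (i + m - j) a\<close>.  For \<open>i = j\<close> this is the last
  extremal coefficient of \<open>a\<close>, and extremality forces \<open>D (m - j) a\<close> to be extremal too.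
\<close>

lemma udeg_D:
  assumes a: "has_udeg a m" and "j \<le> m" and nz: "of_nat (m choose j) \<noteq> (0 :: 'k poly fract poly)"
  shows "has_udeg (D (m - j) a) j" and "real (degree (D (m - j) a)) = degree a + real (m - j) * \<mu>"
proof -
  have A: "a \<in> A" using a unfolding has_udeg_def by simp
  have comp: "D i (D (m - j) a) = of_nat ((i + (m - j)) choose i) * D (i + (m - j)) a" for i
    using A by (rule D_comp)
  have deg_of_nat: "degree (of_nat c :: 'k poly fract poly) = 0" for c
    by (metis degree_of_nat)
  have top: "D j (D (m - j) a) \<noteq> 0" "real (degree (D j (D (m - j) a))) = degree a + m * \<mu>"
    using a nz \<open>j \<le> m\<close> unfolding comp has_udeg_def by (auto simp: degree_mult_eq deg_of_nat)
  have "D (m - j) a \<noteq> 0" using top(1) by (auto simp: D_zero)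
  then have "real (degree (D (m - j) a)) \<le> degree a + real (m - j) * \<mu>"
    using weight[OF A, of "m - j"] unfolding deg_le_def by auto
  moreover have "degree a + m * \<mu> \<le> degree (D (m - j) a) + j * \<mu>"
    using weight[of "D (m - j) a" j] A top unfolding deg_le_def by auto
  ultimately show deg: "real (degree (D (m - j) a)) = degree a + real (m - j) * \<mu>"
    using \<open>j \<le> m\<close> by (simp add: of_nat_diff algebra_simps)
  have "deg_less (D i (D (m - j) a)) (degree (D (m - j) a) + i * \<mu>)" if "i > j" for i
  proof -
    have "i + (m - j) > m" using that \<open>j \<le> m\<close> by linarith
    then have "deg_less (D (i + (m - j)) a) (degree a + real (i + (m - j)) * \<mu>)"
      using a unfolding has_udeg_def by blast
    moreover have "degree a + real (i + (m - j)) * \<mu> = degree (D (m - j) a) + i * \<mu>"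
      unfolding deg by (simp add: algebra_simps)
    ultimately show ?thesis
      unfolding comp deg_less_def
      by (cases "of_nat ((i + (m - j)) choose i) = (0 :: 'k poly fract poly)";
          cases "D (i + (m - j)) a = 0") (auto simp: degree_mult_eq deg_of_nat)
  qed
  moreover have "real (degree (D j (D (m - j) a))) = degree (D (m - j) a) + j * \<mu>"
    unfolding top(2) deg using \<open>j \<le> m\<close> by (simp add: of_nat_diff algebra_simps)
  ultimately show "has_udeg (D (m - j) a) j"
    unfolding has_udeg_def using A top(1) by simp
qed

lemma udeg_top:
  assumes "has_udeg a m"
  shows "has_udeg (D m a) 0" and "real (degree (D m a)) = degree a + m * \<mu>"
  using udeg_D[OF assms, of 0] by simp_all

text \<open>
  The coefficients \<open>D M z\<close> and \<open>D N x\<close> have \<open>U\<close>-degree zero, which restricts the monomials that can be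
  their leading terms.  Their degrees then pin down the sign of \<open>\<mu>\<close>.
\<close>

lemma slope_negative:
  assumes x: "has_udeg xx N" and y: "has_udeg yy L" and z: "has_udeg zz M"
    and nontrivial: "N > 0 \<or> L > 0 \<or> M > 0"
  shows "\<mu> < 0"
proof -
  have rel: "n * N + L = 2 * M" using udeg_relation[OF x y z] .
  with nontrivial n_ge_2 have "M > 0" by (cases "M = 0") auto
  obtain b e d where qb: "e \<in> {0, 1}" "degree (D M zz) = 2 * b + e" "0 = d + b * L + e * M"
    using udeg_decompose[OF x y z udeg_top(1)[OF z]] by metis
  with \<open>M > 0\<close> have "e = 0" "b * L = 0" by auto
  have degz: "2 * real b = 1 + M * \<mu>"
    using udeg_top(2)[OF z] qb(2) \<open>e = 0\<close> by simp
  show ?thesis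
  proof (cases "L = 0")
    case False
    with \<open>b * L = 0\<close> degz have "M * \<mu> = -1" by simp
    with \<open>M > 0\<close> show ?thesis by (metis mult_nonneg_nonneg not_less of_nat_0_le_iff neg_0_le_iff_le not_one_le_zero)
  next
    case True
    with rel have nN: "n * N = 2 * M" by simp
    with \<open>M > 0\<close> have "N > 0" by (cases "N = 0") auto
    obtain b' e' d' where qb': "e' \<in> {0, 1}" "degree (D N xx) = 2 * b' + e'" "0 = d' + b' * L + e' * M"
      using udeg_decompose[OF x y z udeg_top(1)[OF x]] by metis
    with \<open>M > 0\<close> have "e' = 0" by auto
    have degx: "2 * real b' = N * \<mu>"
      using udeg_top(2)[OF x] qb'(2) \<open>e' = 0\<close> by simp
    have "real n * N = 2 * M" using nN by (metis of_nat_mult of_nat_numeral)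
    then have "real n * (2 * real b') = 2 * (2 * real b - 1)"
      unfolding degx using degz by (simp add: algebra_simps)
    then have "real (n * b' + 1) = real (2 * b)" by simp
    \<comment> \<open>comparing the degrees of \<open>(D N x)\<^sup>n\<close> and \<open>(D M z)\<^sup>2\<close>, which differ by two since \<open>n N = 2 M\<close>\<close>
    then have nb: "n * b' + 1 = 2 * b" by linarith
    then have "odd (n * b')" by (metis dvd_triv_left even_plus_one_iff)
    then have "odd n" by simp
    then have "even N" using nN by (metis dvd_triv_left even_mult_iff)
    have "n \<ge> 3" using \<open>odd n\<close> n_ge_2 by (cases "n = 2") auto
    then have "3 * N \<le> 2 * M" unfolding nN[symmetric] by simp
    then have "N < M" using \<open>N > 0\<close> by linarith
    \<comment> \<open>\<open>U\<close>-degrees are combinations of \<open>N\<close> and \<open>M > N\<close>\<close>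
    have gap: "\<not> has_udeg a j" if "0 < j" "j < N" for a j
    proof
      assume "has_udeg a j"
      then obtain q c e d where c: "q \<noteq> 0" "has_udeg (base q) d" "j = d + c * L + e * M"
        using udeg_decompose[OF x y z] by metis
      have "d = N * degree q" using udeg_unique[OF c(2) udeg_base[OF x \<open>N > 0\<close> c(1)]] .
      with c(3) True have j: "j = N * degree q + e * M" by simp
      show False
      proof (cases "degree q = 0 \<and> e = 0")
        case False
        then have "N \<le> N * degree q \<or> M \<le> e * M" by auto
        then show False using j that \<open>N < M\<close> by linarith
      qed (use j that in simp)
    qed
    \<comment> \<open>otherwise \<open>D (N - j) x\<close> and \<open>D (M - j) z\<close> would have the \<open>U\<close>-degree \<open>j\<close>\<close>
    have zeroN: "of_nat (N choose j) = (0 :: 'k poly fract poly)" if "0 < j" "j < N" for j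
      using gap[OF that] udeg_D(1)[OF x, of j] that by auto
    have zeroM: "of_nat (M choose j) = (0 :: 'k poly fract poly)" if "0 < j" "j < N" for j
      using gap[OF that] udeg_D(1)[OF z, of j] that \<open>N < M\<close> by auto
    have two: "(2 :: 'k poly fract poly) = 0"
      using choose_middle_zero_char_2[OF \<open>even N\<close> \<open>N > 0\<close> zeroN] .
    have "of_nat n = (of_nat (n * N choose N) :: 'k poly fract poly)"
      using choose_multiple[OF \<open>N > 0\<close> zeroN, of n] by simp
    also have "\<dots> = 2 * of_nat (M choose N)"
      unfolding nN by (rule choose_double[OF \<open>N > 0\<close> zeroM])
    also have "\<dots> = 0" using two by simp
    finally have "of_nat n = (0 :: 'k poly fract poly)" .
    moreover from \<open>odd n\<close> obtain k where "n = 2 * k + 1" by (rule oddE)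
    ultimately show ?thesis using two by simp
  qed
qed

end

context danielewski_hasse
begin

text \<open>
  Were some \<open>D i x\<close> with \<open>i > 0\<close> nonzero, the set of slopes would be nonempty and its maximum \<open>\<mu>\<close> attained.
  The maximum is negative, and then so is the bound \<open>i * \<mu>\<close> for the degree of \<open>D i x\<close>.
\<close>

lemma D_xx: "i > 0 \<Longrightarrow> D i xx = 0"
proof -
  define S where "S = (\<Union>g\<in>{xx, yy, zz}. (\<lambda>i. (real (degree (D i g)) - degree g) / i) ` {i. i > 0 \<and> D i g \<noteq> 0})"
  have "finite {i. i > 0 \<and> D i g \<noteq> 0}" if "g \<in> A" for g
    using D_finite[OF that] by (rule finite_subset[rotated]) auto
  then have fin: "finite S" unfolding S_def by auto
  show "D i xx = 0" if "i > 0" for i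
  proof (rule ccontr)
    assume nz: "D i xx \<noteq> 0"
    then have "(real (degree (D i xx)) - degree xx) / i \<in> S"
      unfolding S_def using that by blast
    then have "S \<noteq> {}" by blast
    define \<mu> where "\<mu> = Max S"
    have "\<mu> \<in> S" unfolding \<mu>_def using fin \<open>S \<noteq> {}\<close> by (rule Max_in)
    have le: "deg_le (D j g) (degree g + j * \<mu>)" if "g \<in> {xx, yy, zz}" for j g
    proof (cases "j > 0 \<and> D j g \<noteq> 0")
      case True
      then have "(real (degree (D j g)) - degree g) / j \<in> S" unfolding S_def using that by blast
      then have "(real (degree (D j g)) - degree g) / j \<le> \<mu>" unfolding \<mu>_def using fin by (intro Max_ge)
      then show ?thesis using True by (simp add: deg_le_def field_simps)
    next
      case False
      with that show ?thesis by (auto simp: deg_le_def D_0)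
    qed
    interpret weighted_hasse n h D \<mu>
      by unfold_locales (use le[of xx] le[of yy] le[of zz] in simp_all)
    obtain N where x: "has_udeg xx N" by (rule udeg_exists[of xx]) auto
    obtain L where y: "has_udeg yy L" by (rule udeg_exists[of yy]) auto
    obtain M where z: "has_udeg zz M" by (rule udeg_exists[of zz]) auto
    have "\<exists>g\<in>{xx, yy, zz}. \<exists>j. j > 0 \<and> D j g \<noteq> 0 \<and> \<mu> = (real (degree (D j g)) - degree g) / j"
      using \<open>\<mu> \<in> S\<close> unfolding S_def by blast
    then obtain g j where g: "g \<in> {xx, yy, zz}" "j > 0" "D j g \<noteq> 0"
      "\<mu> = (real (degree (D j g)) - degree g) / j"
      by blast
    then have "\<not> deg_less (D j g) (degree g + j * \<mu>)" by (simp add: deg_less_def)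
    \<comment> \<open>the generator that attains \<open>\<mu>\<close> has positive \<open>U\<close>-degree\<close>
    then have "m > 0" if "has_udeg g m" for m
      using that g(2) unfolding has_udeg_def by (cases "m = 0") auto
    with g(1) x y z have "N > 0 \<or> L > 0 \<or> M > 0" by blast
    from slope_negative[OF x y z this] have "i * \<mu> < 0" using \<open>i > 0\<close> by (simp add: mult_pos_neg)
    moreover have "real (degree (D i xx)) \<le> i * \<mu>"
      using weight_xx[of i] nz by (simp add: deg_le_def)
    ultimately show False by linarith
  qed
qed

end

section \<open>Exponential maps in terms of coefficients\<close>

lemma UP_coeff: "p \<in> carrier (UP A) \<Longrightarrow> up_ring.coeff (UP A) p m = p m"
  by (simp add: UP_def)

context UP_ring
begin

lemma coeff_apply: "p \<in> carrier P \<Longrightarrow> up_ring.coeff P p m = p m"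
  unfolding P_def by (rule UP_coeff)

lemma apply_closed: "p \<in> carrier P \<Longrightarrow> p i \<in> carrier R"
  by (auto simp: P_def UP_def)

lemma monom_apply: "a \<in> carrier R \<Longrightarrow> up_ring.monom P a m i = (if m = i then a else \<zero>)"
  using coeff_monom[of a m i] by (simp add: coeff_apply)

lemma const_mult_apply:
  assumes "a \<in> carrier R" "p \<in> carrier P"
  shows "(up_ring.monom P a 0 \<otimes>\<^bsub>P\<^esub> p) i = a \<otimes> p i"
  using assms coeff_smult[OF assms, of i] by (simp add: monom_mult_is_smult coeff_apply)

lemma var_mult_apply:
  assumes "p \<in> carrier P"
  shows "(up_ring.monom P \<one> 1 \<otimes>\<^bsub>P\<^esub> p) i = (case i of 0 \<Rightarrow> \<zero> | Suc j \<Rightarrow> p j)"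
proof -
  let ?q = "up_ring.monom P \<one> 1 \<otimes>\<^bsub>P\<^esub> p"
  have "?q i = up_ring.coeff P ?q i" using assms by (simp add: coeff_apply)
  moreover have "up_ring.coeff P ?q 0 = \<zero>"
    using assms coeff_mult[of "up_ring.monom P \<one> 1" p 0] by (simp add: coeff_apply apply_closed monom_apply)
  moreover have "up_ring.coeff P ?q (Suc j) = p j" for j
    using assms coeff_monom_mult[of \<one> p 1 j] by (simp add: coeff_apply apply_closed)
  ultimately show ?thesis by (cases i) simp_all
qed

lemma add_apply: "p \<in> carrier P \<Longrightarrow> q \<in> carrier P \<Longrightarrow> (p \<oplus>\<^bsub>P\<^esub> q) i = p i \<oplus> q i"
  using coeff_add[of p q i] by (simp add: coeff_apply)

lemma zero_apply: "\<zero>\<^bsub>P\<^esub> i = \<zero>"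
  using coeff_apply[OF UP_zero_closed, of i] by simp

lemma one_apply: "\<one>\<^bsub>P\<^esub> i = (if i = 0 then \<one> else \<zero>)"
  using coeff_apply[OF UP_one_closed, of i] by simp

lemma mult_apply:
  "p \<in> carrier P \<Longrightarrow> q \<in> carrier P \<Longrightarrow> (p \<otimes>\<^bsub>P\<^esub> q) m = (\<Oplus>i\<in>{..m}. p i \<otimes> q (m - i))"
  using coeff_mult[of p q m] by (simp add: coeff_apply)

lemma finsum_apply:
  assumes "finite S" "f \<in> S \<rightarrow> carrier P"
  shows "(finsum P f S) i = (\<Oplus>j\<in>S. f j i)"
proof -
  interpret P: ring P by (rule UP_ring)
  have f: "f j \<in> carrier P" if "j \<in> S" for j using assms(2) that by blast
  have "(finsum P f S) i = up_ring.coeff P (finsum P f S) i"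
    using P.finsum_closed[OF assms(2)] by (rule coeff_apply[symmetric])
  also have "\<dots> = (\<Oplus>j\<in>S. up_ring.coeff P (f j) i)" using assms by (rule coeff_finsum)
  also have "\<dots> = (\<Oplus>j\<in>S. f j i)"
  proof (rule R.finsum_cong')
    show "(\<lambda>j. f j i) \<in> S \<rightarrow> carrier R" using f apply_closed by blast
    show "up_ring.coeff P (f j) i = f j i" if "j \<in> S" for j using f[OF that] by (rule coeff_apply)
  qed simp
  finally show ?thesis .
qed

lemma above_deg_apply: "p \<in> carrier P \<Longrightarrow> deg R p < m \<Longrightarrow> p m = \<zero>"
  using deg_aboveD[of p m] by (simp add: coeff_apply)

end

lemma (in abelian_monoid) finsum_delta:
  assumes "finite S" "f \<in> S \<rightarrow> carrier G" "k \<notin> S \<Longrightarrow> f k = \<zero>"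
  shows "(\<Oplus>i\<in>S. if i = k then f i else \<zero>) = f k"
proof (cases "k \<in> S")
  case True
  have "(\<Oplus>i\<in>S. if i = k then f i else \<zero>) = (\<Oplus>i\<in>S. if k = i then f i else \<zero>)"
    using assms(2) by (intro finsum_cong') auto
  also have "\<dots> = f k" by (rule add.finprod_singleton[OF True assms(1,2)])
  finally show ?thesis .
next
  case False
  have "(\<Oplus>i\<in>S. if i = k then f i else \<zero>) = (\<Oplus>i\<in>S. \<zero>)"
    using False by (intro finsum_cong') auto
  then show ?thesis using assms(3) False by simp
qed

text \<open>
  Elements of \<open>A[S][U]\<close> are families \<open>p j i\<close>, where \<open>j\<close> is the exponent of \<open>U\<close> and \<open>i\<close> that of \<open>S\<close>.
\<close>

locale UP_iterated = cring A for A (structure)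
begin

sublocale P: UP_cring A "UP A"
  by unfold_locales simp

sublocale P2: UP_cring "UP A" "UP (UP A)"
  by (rule UP_cring.intro) (rule P.UP_cring)

abbreviation (input) "U \<equiv> UP_var (UP A)"
abbreviation (input) "S \<equiv> UP_const (UP A) (UP_var A)"

lemma vars_closed [simp]: "U \<in> carrier (UP (UP A))" "S \<in> carrier (UP (UP A))" "UP_var A \<in> carrier (UP A)"
  by (simp_all add: UP_var_def UP_const_def)

lemma extend_exp_apply:
  assumes \<phi>: "\<phi> \<in> ring_hom A (UP A)" and p: "p \<in> carrier (UP A)"
  shows "extend_exp A \<phi> p j = \<phi> (p j)"
proof -
  have cl: "\<phi> (p k) \<in> carrier (UP A)" for k
    using \<phi> P.apply_closed[OF p] by (rule ring_hom_closed)
  have summand: "(UP_const (UP A) \<circ> \<phi>) (up_ring.coeff (UP A) p k) \<otimes>\<^bsub>UP (UP A)\<^esub> U [^]\<^bsub>UP (UP A)\<^esub> k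
      = up_ring.monom (UP (UP A)) (\<phi> (p k)) k" for k
    using cl[of k] P2.monom_mult[OF cl[of k] P.UP_one_closed, of 0 k]
    by (simp add: UP_coeff[OF p] UP_const_def UP_var_def P2.monom_pow)
  have "extend_exp A \<phi> p = (\<Oplus>\<^bsub>UP (UP A)\<^esub>k\<in>{..deg A p}. up_ring.monom (UP (UP A)) (\<phi> (p k)) k)"
    unfolding extend_exp_def P.eval_on_carrier[OF p] summand ..
  then have "extend_exp A \<phi> p j = (\<Oplus>\<^bsub>UP A\<^esub>k\<in>{..deg A p}. up_ring.monom (UP (UP A)) (\<phi> (p k)) k j)"
    using cl by (simp add: P2.finsum_apply)
  also have "\<dots> = (\<Oplus>\<^bsub>UP A\<^esub>k\<in>{..deg A p}. if k = j then \<phi> (p k) else \<zero>\<^bsub>UP A\<^esub>)"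
    using cl by (intro P.P.finsum_cong') (auto simp: P2.monom_apply)
  also have "\<dots> = \<phi> (p j)"
    using cl P.above_deg_apply[OF p] ring_hom_zero[OF \<phi> ring_axioms P.UP_ring]
    by (intro P.P.finsum_delta) auto
  finally show ?thesis .
qed

text \<open>
  The binomial theorem for \<open>(S + U)\<^sup>k\<close>, by Pascal's recursion: multiplication by \<open>S\<close> or \<open>U\<close> shifts one of the
  two indices.
\<close>

lemma power_sum_apply:
  "((S \<oplus>\<^bsub>UP (UP A)\<^esub> U) [^]\<^bsub>UP (UP A)\<^esub> k) j i =
    (if i + j = k then [(k choose j)] \<cdot> \<one> else \<zero>)"
proof (induction k arbitrary: i j)
  case 0
  then show ?case by (auto simp: P2.one_apply P.one_apply P.zero_apply)
next
  case (Suc k)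
  let ?W = "(S \<oplus>\<^bsub>UP (UP A)\<^esub> U) [^]\<^bsub>UP (UP A)\<^esub> k"
  have W: "?W \<in> carrier (UP (UP A))" by simp
  have Wj: "?W j \<in> carrier (UP A)" for j using P2.apply_closed[OF W] .
  have "(S \<oplus>\<^bsub>UP (UP A)\<^esub> U) [^]\<^bsub>UP (UP A)\<^esub> Suc k =
      S \<otimes>\<^bsub>UP (UP A)\<^esub> ?W \<oplus>\<^bsub>UP (UP A)\<^esub> U \<otimes>\<^bsub>UP (UP A)\<^esub> ?W"
    using W by (simp add: P2.P.m_comm P2.P.l_distr P2.P.r_distr)
  then have "((S \<oplus>\<^bsub>UP (UP A)\<^esub> U) [^]\<^bsub>UP (UP A)\<^esub> Suc k) j i =
      (UP_var A \<otimes>\<^bsub>UP A\<^esub> ?W j) i \<oplus> (U \<otimes>\<^bsub>UP (UP A)\<^esub> ?W) j i"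
    using W Wj P2.apply_closed[of "U \<otimes>\<^bsub>UP (UP A)\<^esub> ?W" j]
    by (simp add: P2.add_apply P.add_apply UP_const_def P2.const_mult_apply)
  also have "(UP_var A \<otimes>\<^bsub>UP A\<^esub> ?W j) i = (case i of 0 \<Rightarrow> \<zero> | Suc i' \<Rightarrow> ?W j i')"
    unfolding UP_var_def by (rule P.var_mult_apply[OF Wj[unfolded UP_var_def]])
  also have "(U \<otimes>\<^bsub>UP (UP A)\<^esub> ?W) j i = (case j of 0 \<Rightarrow> \<zero> | Suc j' \<Rightarrow> ?W j' i)"
    unfolding UP_var_def P2.var_mult_apply[OF W[unfolded UP_var_def]] by (simp add: P.zero_apply split: nat.split)
  finally show ?case
    by (auto simp: Suc.IH add.nat_pow_mult[symmetric] a_comm binomial_eq_0 split: nat.split)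
qed

lemma exp_at_sum_apply:
  assumes p: "\<phi> a \<in> carrier (UP A)"
  shows "exp_at_sum A \<phi> a j i = [((i + j) choose j)] \<cdot> \<phi> a (i + j)"
proof -
  let ?V = "S \<oplus>\<^bsub>UP (UP A)\<^esub> U"
  let ?p = "\<phi> a"
  have cl: "?p k \<in> carrier A" for k using P.apply_closed[OF p] .
  have Vcl: "?V [^]\<^bsub>UP (UP A)\<^esub> k \<in> carrier (UP (UP A))" for k :: nat by simp
  note Vj = P2.apply_closed[OF Vcl]
  let ?t = "\<lambda>k. UP_const (UP A) (UP_const A (?p k)) \<otimes>\<^bsub>UP (UP A)\<^esub> ?V [^]\<^bsub>UP (UP A)\<^esub> k"
  have tcl: "?t k \<in> carrier (UP (UP A))" for k
    using cl Vcl by (simp add: UP_const_def)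
  have t: "?t k j i = (if k = i + j then [(k choose j)] \<cdot> ?p k else \<zero>)" for k
  proof -
    have "?t k j i = ?p k \<otimes> (?V [^]\<^bsub>UP (UP A)\<^esub> k) j i"
      using cl Vcl Vj by (simp add: UP_const_def P2.const_mult_apply P.const_mult_apply)
    then show ?thesis
      using cl[of k] add_pow_rdistr[of "?p k" \<one> "k choose j"] by (auto simp: power_sum_apply)
  qed
  have "exp_at_sum A \<phi> a = (\<Oplus>\<^bsub>UP (UP A)\<^esub>k\<in>{..deg A ?p}. ?t k)"
    unfolding exp_at_sum_def P.eval_on_carrier[OF p] by (simp add: UP_coeff[OF p])
  then have "exp_at_sum A \<phi> a j i = (\<Oplus>k\<in>{..deg A ?p}. ?t k j i)"
    using tcl P2.apply_closed[OF tcl] by (simp add: P2.finsum_apply P.finsum_apply)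
  also have "\<dots> = (\<Oplus>k\<in>{..deg A ?p}. if k = i + j then [(k choose j)] \<cdot> ?p k else \<zero>)"
    unfolding t ..
  also have "\<dots> = [((i + j) choose j)] \<cdot> ?p (i + j)"
    using cl P.above_deg_apply[OF p] by (intro finsum_delta) auto
  finally show ?thesis .
qed

lemma eval_0:
  assumes p: "p \<in> carrier (UP A)"
  shows "UnivPoly.eval A A (\<lambda>b. b) \<zero> p = p 0"
proof -
  have cl: "p k \<in> carrier A" for k using P.apply_closed[OF p] .
  have "UnivPoly.eval A A (\<lambda>b. b) \<zero> p = (\<Oplus>k\<in>{..deg A p}. p k \<otimes> \<zero> [^] k)"
    unfolding P.eval_on_carrier[OF p] by (simp add: UP_coeff[OF p])
  also have "\<dots> = (\<Oplus>k\<in>{..deg A p}. if k = 0 then p k else \<zero>)"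
    using cl by (intro finsum_cong') (auto simp: nat_pow_zero)
  also have "\<dots> = p 0"
    using cl by (intro finsum_delta) auto
  finally show ?thesis .
qed

text \<open>
  The form in which exponential maps are both used and constructed: the evaluations in the
  definition have disappeared, and the group law is the iteration rule of a Hasse-Schmidt
  derivation.
\<close>

lemma exponential_map_iff:
  assumes \<iota>: "\<And>c. c \<in> carrier K \<Longrightarrow> \<iota> c \<in> carrier A"
  shows "exponential_map K A \<iota> \<phi> \<longleftrightarrow> \<phi> \<in> ring_hom A (UP A) \<and>
    (\<forall>c\<in>carrier K. \<forall>i>0. \<phi> (\<iota> c) i = \<zero>) \<and>
    (\<forall>a\<in>carrier A. \<phi> a 0 = a) \<and>
    (\<forall>a\<in>carrier A. \<forall>i j. \<phi> (\<phi> a j) i = [((i + j) choose j)] \<cdot> \<phi> a (i + j))"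
proof (cases "\<phi> \<in> ring_hom A (UP A)")
  case True
  have cl: "\<phi> a \<in> carrier (UP A)" if "a \<in> carrier A" for a
    using True that by (rule ring_hom_closed)
  have 1: "(\<forall>a\<in>carrier A. extend_exp A \<phi> (\<phi> a) = exp_at_sum A \<phi> a) \<longleftrightarrow>
      (\<forall>a\<in>carrier A. \<forall>i j. \<phi> (\<phi> a j) i = [((i + j) choose j)] \<cdot> \<phi> a (i + j))"
    by (auto simp: fun_eq_iff extend_exp_apply[OF True cl] exp_at_sum_apply[of \<phi>, OF cl])
  have 2: "(\<forall>a\<in>carrier A. UnivPoly.eval A A (\<lambda>b. b) \<zero> (\<phi> a) = a) \<longleftrightarrow> (\<forall>a\<in>carrier A. \<phi> a 0 = a)"
    by (simp add: eval_0 cl)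
  have 3: "\<phi> (\<iota> c) = UP_const A (\<iota> c) \<longleftrightarrow> (\<forall>i>0. \<phi> (\<iota> c) i = \<zero>)"
    if "\<forall>a\<in>carrier A. \<phi> a 0 = a" "c \<in> carrier K" for c
  proof
    assume "\<forall>i>0. \<phi> (\<iota> c) i = \<zero>"
    then show "\<phi> (\<iota> c) = UP_const A (\<iota> c)"
      using that \<iota> by (auto simp: fun_eq_iff UP_const_def P.monom_apply)
  qed (use \<iota> that in \<open>auto simp: UP_const_def P.monom_apply\<close>)
  show ?thesis
    unfolding exponential_map_def 1 2 using True 3 by blast
qed (simp add: exponential_map_def)

lemma exp_invariants_iff:
  assumes "\<And>a. a \<in> carrier A \<Longrightarrow> \<phi> a 0 = a"
  shows "exp_invariants A \<phi> = {a \<in> carrier A. \<forall>i>0. \<phi> a i = \<zero>}"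
  using assms by (auto simp: exp_invariants_def fun_eq_iff UP_const_def P.monom_apply)

end

section \<open>Transfer between the quotient ring and \<open>k(x)[z]\<close>\<close>

context danielewski
begin

abbreviation "T \<equiv> (ring_of_type_algebra :: 'k poly fract poly ring)"
abbreviation "R \<equiv> surfR n h"

lemma T_simps [simp]:
  "carrier T = UNIV" "a \<otimes>\<^bsub>T\<^esub> b = a * b" "a \<oplus>\<^bsub>T\<^esub> b = a + b" "\<one>\<^bsub>T\<^esub> = 1" "\<zero>\<^bsub>T\<^esub> = 0"
  by (simp_all add: ring_of_type_algebra_def)

lemma emb_ring_hom: "ring_hom_ring polyXYZ T emb"
  by (intro ring_hom_ringI2 ring_from_type_algebra ring_hom_memI)
    (simp_all add: ring_of_type_algebra_def)

lemma kernel_emb: "a_kernel polyXYZ T emb = rel_ideal n h"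
  unfolding rel_ideal_def rel_def[symmetric]
  by (auto simp: a_kernel_def' cgenideal_def ring_of_type_algebra_def emb_eq_0_iff mult.commute
      elim!: dvdE)

text \<open>
  \<open>emb\<close> is constant on residue classes; \<open>realize\<close> is the injective homomorphism that it induces on the quotient
  ring, and \<open>lift\<close> is the inverse of \<open>realize\<close> on its image.
\<close>

definition realize :: "'k poly poly poly set \<Rightarrow> 'k poly fract poly"
  where "realize u = the_elem (emb ` u)"

lemma R_cring: "cring R"
  using surfR_algebra[of n h] by (rule ring_hom_cring.axioms(2))

sublocale R: cring R
  by (rule R_cring)

sublocale UP_iterated R
  by unfold_locales

lemma realize_ring_hom: "ring_hom_ring R T realize"
  using ring_hom_ring.the_elem_hom[OF emb_ring_hom] R.ring_axioms
  unfolding kernel_emb surfR_def[symmetric] realize_def[symmetric]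
  by (intro ring_hom_ringI2 ring_from_type_algebra)

sublocale realize: ring_hom_ring R T realize
  by (rule realize_ring_hom)

lemma realize_inj: "inj_on realize (carrier R)"
  using ring_hom_ring.the_elem_inj[OF emb_ring_hom]
  unfolding kernel_emb surfR_def[symmetric] realize_def[symmetric] inj_on_def by blast

lemma realize_eqI: "u \<in> carrier R \<Longrightarrow> v \<in> carrier R \<Longrightarrow> realize u = realize v \<Longrightarrow> u = v"
  using realize_inj by (auto dest: inj_onD)

lemma realize_image: "realize ` carrier R = A"
  using ring_hom_ring.the_elem_surj[OF emb_ring_hom]
  unfolding kernel_emb surfR_def[symmetric] realize_def[symmetric] A_def
  by (simp add: ring_of_type_algebra_def)

lemma realize_coset: "realize (surfR_coset n h P) = emb P"
  using ring_hom_ring.the_elem_simp[OF emb_ring_hom, of P]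
  unfolding kernel_emb realize_def surfR_coset_def by (simp add: ring_of_type_algebra_def)

lemma coset_closed: "surfR_coset n h P \<in> carrier R"
  unfolding surfR_coset_def surfR_def FactRing_def A_RCOSETS_def' by (auto simp: ring_of_type_algebra_def)

lemma realize_const: "realize (surfR_const n h c) = base [:c:]"
  unfolding surfR_const_def realize_coset by simp

lemma realize_x: "realize (surfR_x n h) = xx"
  unfolding surfR_x_def realize_coset by simp

lemma realize_finsum:
  "finite I \<Longrightarrow> f \<in> I \<rightarrow> carrier R \<Longrightarrow> realize (finsum R f I) = (\<Sum>i\<in>I. realize (f i))"
  by (induction I rule: finite_induct) (simp_all add: Pi_def)

lemma realize_nat: "u \<in> carrier R \<Longrightarrow> realize ([(m::nat)] \<cdot>\<^bsub>R\<^esub> u) = of_nat m * realize u"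
  by (induction m) (simp_all add: algebra_simps)

definition lift :: "'k poly fract poly \<Rightarrow> 'k poly poly poly set"
  where "lift = the_inv_into (carrier R) realize"

lemma lift [simp]:
  "u \<in> carrier R \<Longrightarrow> lift (realize u) = u" "a \<in> A \<Longrightarrow> realize (lift a) = a" "a \<in> A \<Longrightarrow> lift a \<in> carrier R"
  unfolding lift_def realize_image[symmetric]
  by (simp_all add: the_inv_into_f_f f_the_inv_into_f the_inv_into_into realize_inj)

lemma realize_in_A [simp]: "u \<in> carrier R \<Longrightarrow> realize u \<in> A"
  using realize_image by blast

lemma const_closed: "surfR_const n h c \<in> carrier R"
  unfolding surfR_const_def by (rule coset_closed)

lemma exponential_map_surf_iff:
  "exponential_map ring_of_type_algebra R (surfR_const n h) \<phi> \<longleftrightarrow> \<phi> \<in> ring_hom R (UP R) \<and>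
    (\<forall>c. \<forall>i>0. \<phi> (surfR_const n h c) i = \<zero>\<^bsub>R\<^esub>) \<and>
    (\<forall>u\<in>carrier R. \<phi> u 0 = u) \<and>
    (\<forall>u\<in>carrier R. \<forall>i j. \<phi> (\<phi> u j) i = [((i + j) choose j)] \<cdot>\<^bsub>R\<^esub> \<phi> u (i + j))"
  using exponential_map_iff[of ring_of_type_algebra "surfR_const n h" \<phi>] const_closed
  by (simp add: ring_of_type_algebra_def)

lemma exponential_map_surfD:
  assumes "exponential_map ring_of_type_algebra R (surfR_const n h) \<phi>"
  shows "\<phi> \<in> ring_hom R (UP R)"
    and "i > 0 \<Longrightarrow> \<phi> (surfR_const n h c) i = \<zero>\<^bsub>R\<^esub>"
    and "u \<in> carrier R \<Longrightarrow> \<phi> u 0 = u"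
    and "u \<in> carrier R \<Longrightarrow> \<phi> (\<phi> u j) i = [((i + j) choose j)] \<cdot>\<^bsub>R\<^esub> \<phi> u (i + j)"
  using assms[unfolded exponential_map_surf_iff] by simp_all

lemma hasse_of_exponential_map:
  assumes "n \<ge> 2" and "exponential_map ring_of_type_algebra R (surfR_const n h) \<phi>"
  shows "danielewski_hasse n h (\<lambda>i a. realize (\<phi> (lift a) i))"
proof
  note \<phi> = exponential_map_surfD[OF assms(2)]
  have UPcl: "\<phi> u \<in> carrier (UP R)" if "u \<in> carrier R" for u
    using \<phi>(1) that by (rule ring_hom_closed)
  then have cl: "\<phi> u i \<in> carrier R" if "u \<in> carrier R" for u i
    using that P.apply_closed by blast
  have inv_add: "lift (a + b) = lift a \<oplus>\<^bsub>R\<^esub> lift b" if "a \<in> A" "b \<in> A" for a b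
    using that lift(1)[of "lift a \<oplus>\<^bsub>R\<^esub> lift b"] by simp
  have inv_mult: "lift (a * b) = lift a \<otimes>\<^bsub>R\<^esub> lift b" if "a \<in> A" "b \<in> A" for a b
    using that lift(1)[of "lift a \<otimes>\<^bsub>R\<^esub> lift b"] by simp
  show "n \<ge> 2" by fact
  show "realize (\<phi> (lift a) i) \<in> A" if "a \<in> A" for a i
    using that cl by simp
  show "realize (\<phi> (lift (a + b)) i) = realize (\<phi> (lift a) i) + realize (\<phi> (lift b) i)" if "a \<in> A" "b \<in> A" for a b i
    using that cl UPcl by (simp add: inv_add ring_hom_add[OF \<phi>(1)] P.add_apply)
  show "realize (\<phi> (lift (a * b)) m) = (\<Sum>i\<le>m. realize (\<phi> (lift a) i) * realize (\<phi> (lift b) (m - i)))"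
    if "a \<in> A" "b \<in> A" for a b m
    using that cl UPcl by (simp add: inv_mult ring_hom_mult[OF \<phi>(1)] P.mult_apply realize_finsum del: realize.hom_finsum)
  show "realize (\<phi> (lift a) 0) = a" if "a \<in> A" for a
    using that by (simp add: \<phi>(3))
  show "realize (\<phi> (lift (base [:c:])) i) = 0" if "i > 0" for i c
  proof -
    have "lift (base [:c:]) = surfR_const n h c"
      using lift(1)[OF const_closed, of c] by (simp add: realize_const)
    then show ?thesis using \<phi>(2)[OF that] by simp
  qed
  show "realize (\<phi> (lift (realize (\<phi> (lift a) j))) i) = of_nat ((i + j) choose i) * realize (\<phi> (lift a) (i + j))"
    if "a \<in> A" for a i j
    using that cl binomial_symmetric[of i "i + j"] by (simp add: \<phi>(4) realize_nat)
  show "finite {i. realize (\<phi> (lift a) i) \<noteq> 0}" if "a \<in> A" for a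
  proof (rule finite_subset)
    show "{i. realize (\<phi> (lift a) i) \<noteq> 0} \<subseteq> {..deg R (\<phi> (lift a))}"
    proof
      fix i assume "i \<in> {i. realize (\<phi> (lift a) i) \<noteq> 0}"
      then have "\<phi> (lift a) i \<noteq> \<zero>\<^bsub>R\<^esub>" by auto
      then show "i \<in> {..deg R (\<phi> (lift a))}"
        using P.above_deg_apply[OF UPcl[OF lift(3)[OF that]], of i] by force
    qed
  qed simp
qed

abbreviation "kx \<equiv> ring.simple_extension R (range (surfR_const n h)) (surfR_x n h)"

lemma x_closed: "surfR_x n h \<in> carrier R"
  unfolding surfR_x_def by (rule coset_closed)

text \<open>
  The invariants of an exponential map form a subalgebra, by the Leibniz rule, and it contains \<open>x\<close>.
\<close>

lemma kx_subset_AK: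
  assumes "n \<ge> 2"
  shows "kx \<subseteq> AK ring_of_type_algebra R (surfR_const n h)"
proof (unfold AK_def, intro INT_greatest)
  fix \<phi> assume "\<phi> \<in> {\<phi>. exponential_map ring_of_type_algebra R (surfR_const n h) \<phi>}"
  then have \<phi>: "exponential_map ring_of_type_algebra R (surfR_const n h) \<phi>" by simp
  interpret danielewski_hasse n h "\<lambda>i a. realize (\<phi> (lift a) i)"
    using assms \<phi> by (rule hasse_of_exponential_map)
  note hom = exponential_map_surfD(1)[OF \<phi>] and \<phi>0 = exponential_map_surfD(3)[OF \<phi>]
  have cl: "\<phi> u i \<in> carrier R" if "u \<in> carrier R" for u i
    using P.apply_closed[OF ring_hom_closed[OF hom that]] .
  have "realize (\<phi> u i) = 0 \<longleftrightarrow> \<phi> u i = \<zero>\<^bsub>R\<^esub>" if "u \<in> carrier R" for u i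
    using realize_eqI[of "\<phi> u i" "\<zero>\<^bsub>R\<^esub>"] cl[OF that, of i] by auto
  moreover have "exp_invariants R \<phi> = {u \<in> carrier R. \<forall>i>0. \<phi> u i = \<zero>\<^bsub>R\<^esub>}"
    by (rule exp_invariants_iff) (rule \<phi>0)
  ultimately have inv: "exp_invariants R \<phi> = {u \<in> carrier R. \<forall>i>0. realize (\<phi> u i) = 0}"
    by (simp cong: conj_cong)
  have x: "realize (\<phi> (surfR_x n h) i) = 0" if "i > 0" for i
    using D_xx[OF that] lift(1)[OF x_closed] by (simp add: realize_x)
  have c: "realize (\<phi> (surfR_const n h c) i) = 0" if "i > 0" for c i
    using D_const[OF that, of c] lift(1)[OF const_closed, of c] by (simp add: realize_const)
  show "kx \<subseteq> exp_invariants R \<phi>"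
  proof
    fix u assume "u \<in> kx"
    then show "u \<in> exp_invariants R \<phi>"
    proof (induction rule: R.simple_extension.induct)
      case zero
      show ?case unfolding inv using D_zero lift(1)[of "\<zero>\<^bsub>R\<^esub>"] by simp
    next
      case (lin u c)
      then obtain c' where c': "c = surfR_const n h c'" by blast
      from lin have u: "u \<in> carrier R" "\<And>i. i > 0 \<Longrightarrow> realize (\<phi> u i) = 0"
        unfolding inv by auto
      have "realize (\<phi> (u \<otimes>\<^bsub>R\<^esub> surfR_x n h \<oplus>\<^bsub>R\<^esub> c) i) = 0" if "i > 0" for i
      proof -
        have "realize (\<phi> (u \<otimes>\<^bsub>R\<^esub> surfR_x n h \<oplus>\<^bsub>R\<^esub> c) i) =
            (\<Sum>j\<le>i. realize (\<phi> u j) * realize (\<phi> (surfR_x n h) (i - j))) + realize (\<phi> c i)"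
          using D_add[of "realize (u \<otimes>\<^bsub>R\<^esub> surfR_x n h)" "realize c" i] D_mult[of "realize u" "realize (surfR_x n h)" i]
            u x_closed const_closed[of c'] lift(1)[of "u \<otimes>\<^bsub>R\<^esub> surfR_x n h \<oplus>\<^bsub>R\<^esub> c"]
            lift(1)[of "u \<otimes>\<^bsub>R\<^esub> surfR_x n h"]
          by (simp add: c')
        also have "realize (\<phi> c i) = 0" unfolding c' by (rule c[OF that])
        also have "(\<Sum>j\<le>i. realize (\<phi> u j) * realize (\<phi> (surfR_x n h) (i - j))) = 0"
        proof (rule sum.neutral, rule ballI)
          fix j
          show "realize (\<phi> u j) * realize (\<phi> (surfR_x n h) (i - j)) = 0"
            using u(2)[of j] x[of "i - j"] that by (cases "j = 0") auto
        qed
        finally show ?thesis by simp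
      qed
      then show ?case unfolding inv using u x_closed const_closed[of c'] by (simp add: c')
    qed
  qed
qed

section \<open>The exponential map \<open>z \<mapsto> z + x\<^sup>n U\<close>\<close>

text \<open>
  The \<open>k(x)\<close>-linear substitution is defined on all of \<open>k(x)[z]\<close>, with values in \<open>k(x)[z][U]\<close>.
\<close>

definition shift :: "'k poly fract poly \<Rightarrow> 'k poly fract poly poly"
  where "shift a = poly (map_poly (\<lambda>c. [:[:c:]:]) a) [:zz, xx ^ n:]"

lemma shift_simps [simp]:
  "shift 0 = 0" "shift (a + b) = shift a + shift b" "shift (a * b) = shift a * shift b"
  "shift (pCons c a) = [:[:c:]:] + [:zz, xx ^ n:] * shift a"
  by (simp_all add: shift_def poly_map_poly_ring_hom map_poly_pCons)

lemma shift_base [simp]: "shift (base q) = [:base q:]"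
  by (simp add: base_def)

lemma shift_1 [simp]: "shift 1 = 1"
  using shift_base[of 1] by (simp flip: one_pCons)

lemma shift_zz [simp]: "shift zz = [:zz, xx ^ n:]"
proof -
  have "zz = pCons 0 1" by (simp add: zz_def one_pCons)
  then have "shift zz = [:[:0:]:] + [:zz, xx ^ n:] * shift 1" by (metis shift_simps(4))
  then show ?thesis by simp
qed

text \<open>
  The factor \<open>x\<^sup>n\<close> in front of \<open>U\<close> compensates the denominator of \<open>y\<close>: this is why the substitution
  preserves the surface ring.
\<close>

lemma shift_yy: "shift yy = [:yy, 2 * zz + base h, xx ^ n:]"
proof -
  have xn: "shift (xx ^ n) = [:xx ^ n:]"
  proof -
    have "xx ^ n = base ([:0, 1:] ^ n)"
      unfolding xx_def by (induction n) (simp_all del: mult_pCons_left)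
    then show ?thesis by simp
  qed
  have "[:xx ^ n:] * shift yy = shift (xx ^ n * yy)"
    by (simp only: shift_simps xn)
  also have "\<dots> = [:zz, xx ^ n:] ^ 2 + [:base h:] * [:zz, xx ^ n:]"
    unfolding surface_relation power2_eq_square by (simp only: shift_simps shift_base shift_zz)
  also have "\<dots> = [:zz ^ 2 + base h * zz, xx ^ n * (2 * zz + base h), xx ^ n * xx ^ n:]"
    by (simp add: power2_eq_square algebra_simps)
  also have "\<dots> = [:xx ^ n:] * [:yy, 2 * zz + base h, xx ^ n:]"
    unfolding surface_relation[symmetric] by simp
  finally have "[:xx ^ n:] * shift yy = [:xx ^ n:] * [:yy, 2 * zz + base h, xx ^ n:]" .
  moreover have "[:xx ^ n:] \<noteq> 0" by simp
  ultimately show ?thesis by (simp only: mult_cancel_left) blast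
qed

lemma coeff_shift_in_A:
  assumes "a \<in> A"
  shows "poly.coeff (shift a) i \<in> A"
proof -
  define B where "B = {p :: 'k poly fract poly poly. \<forall>i. poly.coeff p i \<in> A}"
  have add: "p + q \<in> B" and mult: "p * q \<in> B" if "p \<in> B" "q \<in> B" for p q
  proof -
    have sum: "(\<Sum>i\<in>I. f i) \<in> A" if "\<And>i. f i \<in> A" for I and f :: "nat \<Rightarrow> _"
      using that by (induction I rule: infinite_finite_induct) auto
    show "p + q \<in> B" "p * q \<in> B" using that by (auto simp: B_def coeff_mult intro: sum)
  qed
  have pC: "pCons c p \<in> B" if "c \<in> A" "p \<in> B" for c p
    using that by (auto simp: B_def coeff_pCons split: nat.split)
  have zero: "0 \<in> B" by (simp add: B_def)
  have base: "[:base q:] \<in> B" for q by (intro pC zero) auto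
  have "shift yy \<in> B" unfolding shift_yy mult_2 by (intro pC zero A_closed A_power)
  then have uv: "shift (embXY f) \<in> B" for f
    by (induction f) (simp_all add: zero add mult base)
  have "shift zz \<in> B" unfolding shift_zz by (intro pC zero A_closed A_power)
  then have "shift (emb P) \<in> B" for P
    by (induction P) (simp_all add: zero add mult uv del: shift_zz)
  with assms show ?thesis unfolding A_def B_def by blast
qed

text \<open>
  The coefficient \<open>x\<^sup>n\<close> of \<open>U\<close> is not a zero divisor, so an invariant must be constant in \<open>z\<close>.
\<close>

lemma degree_shift: "a \<noteq> 0 \<Longrightarrow> shift a \<noteq> 0 \<and> degree (shift a) = degree a"
proof (induction a)
  case (pCons c a)
  show ?case
  proof (cases "a = 0")
    case False
    have "degree [:zz, xx ^ n:] = 1" by simp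
    then have deg: "degree ([:zz, xx ^ n:] * shift a) = Suc (degree a)"
      using pCons.IH[OF False] by (subst degree_mult_eq) auto
    then have "degree ([:[:c:]:] + [:zz, xx ^ n:] * shift a) = Suc (degree a)"
      by (subst degree_add_eq_right) simp_all
    then show ?thesis unfolding shift_simps using False by (metis degree_0 degree_pCons_eq nat.distinct(1))
  qed (use pCons.hyps in simp)
qed simp

lemma poly_additive_induct:
  assumes "\<And>c m. Q (Polynomial.monom c m)" "\<And>p q. Q p \<Longrightarrow> Q q \<Longrightarrow> Q (p + q)"
  shows "Q (p :: 'a::comm_monoid_add poly)"
proof -
  have "Q (\<Sum>i\<in>I. Polynomial.monom (poly.coeff p i) i)" for I :: "nat set"
    using assms(1)[of 0 0] by (induction I rule: infinite_finite_induct) (simp_all add: assms)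
  from this[of "{..degree p}"] show ?thesis by (simp add: poly_as_sum_of_monoms)
qed

lemma coeff_shift_monom:
  "poly.coeff (shift (Polynomial.monom c m)) i =
    Polynomial.monom (c * (of_nat (m choose i) * (to_fract [:0, 1:] ^ n) ^ i)) (m - i)"
proof -
  have "shift (Polynomial.monom c m) = [:[:c:]:] * [:zz, xx ^ n:] ^ m"
    by (simp add: shift_def map_poly_monom poly_monom)
  then have coeff: "poly.coeff (shift (Polynomial.monom c m)) i =
      smult c (poly.coeff ([:zz, xx ^ n:] ^ m) i)"
    by simp
  have zz_power: "zz ^ k = Polynomial.monom 1 k" for k
    by (simp add: zz_def monom_altdef)
  show ?thesis
  proof (cases "i \<le> m")
    case True
    have "poly.coeff ([:zz, xx ^ n:] ^ m) i =
        [:of_nat (m choose i):] * [:(to_fract [:0, 1:] ^ n) ^ i:] * Polynomial.monom 1 (m - i)"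
      unfolding coeff_linear_poly_power[OF True] xx_power poly_const_pow zz_power of_nat_poly ..
    then show ?thesis
      unfolding coeff by (simp add: smult_monom)
  next
    case False
    have "degree ([:zz, xx ^ n:] ^ m) \<le> m"
      using degree_power_le[of "[:zz, xx ^ n:]" m] by simp
    then show ?thesis unfolding coeff using False by (simp add: coeff_eq_0 binomial_eq_0)
  qed
qed

text \<open>
  Both sides are additive, and on monomials the claim is the trinomial identity
  \<open>(m choose j) (m - j choose i) = (i + j choose j) (m choose i + j)\<close>.
\<close>

lemma shift_iterate:
  "poly.coeff (shift (poly.coeff (shift a) j)) i = of_nat ((i + j) choose j) * poly.coeff (shift a) (i + j)"
proof (induction a rule: poly_additive_induct)
  case (1 c m)
  have "(m choose j) * ((m - j) choose i) = ((i + j) choose j) * (m choose (i + j))"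
  proof (cases "i + j \<le> m")
    case True
    then show ?thesis using choose_mult[of j "i + j" m] by (simp add: mult.commute)
  next
    case False
    then show ?thesis by (cases "j \<le> m") (simp_all add: binomial_eq_0)
  qed
  then have "of_nat (m choose j) * of_nat ((m - j) choose i) =
      (of_nat ((i + j) choose j) * of_nat (m choose (i + j)) :: 'k poly fract)"
    by (metis of_nat_mult)
  then have "of_nat (m choose j) * t ^ j * (of_nat ((m - j) choose i) * t ^ i) =
      of_nat ((i + j) choose j) * (of_nat (m choose (i + j)) * t ^ (i + j))" for t :: "'k poly fract"
    by (simp add: power_add mult_ac)
  then show ?case
    unfolding coeff_shift_monom of_nat_poly
    by (simp add: smult_monom diff_diff_left add.commute mult.assoc mult.left_commute[of _ c])
qed (simp add: distrib_left)

definition shift_map :: "'k poly poly poly set \<Rightarrow> nat \<Rightarrow> 'k poly poly poly set"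
  where "shift_map u i = lift (poly.coeff (shift (realize u)) i)"

lemma realize_shift_map [simp]:
  "u \<in> carrier R \<Longrightarrow> realize (shift_map u i) = poly.coeff (shift (realize u)) i"
  "u \<in> carrier R \<Longrightarrow> shift_map u i \<in> carrier R"
  unfolding shift_map_def by (simp_all add: coeff_shift_in_A)

lemma coeff_shift_0: "poly.coeff (shift a) 0 = a"
proof (induction a rule: poly_additive_induct)
  case (1 c m)
  show ?case by (simp add: coeff_shift_monom)
qed simp

lemma shift_map_closed:
  assumes u: "u \<in> carrier R"
  shows "shift_map u \<in> carrier (UP R)"
proof -
  have "bound \<zero>\<^bsub>R\<^esub> (degree (shift (realize u))) (shift_map u)"
  proof
    fix i assume "degree (shift (realize u)) < i"
    then show "shift_map u i = \<zero>\<^bsub>R\<^esub>" using u by (intro realize_eqI) (simp_all add: coeff_eq_0)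
  qed
  then have "shift_map u \<in> up R"
    using realize_shift_map(2)[OF u] by (intro mem_upI exI)
  then show ?thesis by (simp only: UP_def partial_object.simps)
qed

lemma shift_map_exponential:
  "exponential_map ring_of_type_algebra R (surfR_const n h) shift_map"
  unfolding exponential_map_surf_iff
proof (intro conjI ballI allI impI)
  show "shift_map \<in> ring_hom R (UP R)"
  proof (rule ring_hom_memI)
    fix u v assume uv: "u \<in> carrier R" "v \<in> carrier R"
    note cl = shift_map_closed[OF uv(1)] shift_map_closed[OF uv(2)]
    show "shift_map (u \<otimes>\<^bsub>R\<^esub> v) = shift_map u \<otimes>\<^bsub>UP R\<^esub> shift_map v"
    proof
      fix i show "shift_map (u \<otimes>\<^bsub>R\<^esub> v) i = (shift_map u \<otimes>\<^bsub>UP R\<^esub> shift_map v) i"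
        using uv cl P.apply_closed[OF P.UP_mult_closed[OF cl]]
        by (intro realize_eqI) (simp_all add: P.mult_apply realize_finsum coeff_mult del: realize.hom_finsum)
    qed
    show "shift_map (u \<oplus>\<^bsub>R\<^esub> v) = shift_map u \<oplus>\<^bsub>UP R\<^esub> shift_map v"
    proof
      fix i show "shift_map (u \<oplus>\<^bsub>R\<^esub> v) i = (shift_map u \<oplus>\<^bsub>UP R\<^esub> shift_map v) i"
        using uv cl by (intro realize_eqI) (simp_all add: P.add_apply)
    qed
  next
    show "shift_map \<one>\<^bsub>R\<^esub> = \<one>\<^bsub>UP R\<^esub>"
    proof
      fix i show "shift_map \<one>\<^bsub>R\<^esub> i = \<one>\<^bsub>UP R\<^esub> i"
        by (intro realize_eqI) (simp_all add: P.one_apply)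
    qed
  qed (rule shift_map_closed)
  show "shift_map (surfR_const n h c) i = \<zero>\<^bsub>R\<^esub>" if "i > 0" for c i
    using that const_closed by (intro realize_eqI) (simp_all add: realize_const coeff_pCons split: nat.split)
  show "shift_map u 0 = u" if "u \<in> carrier R" for u
    using that by (intro realize_eqI) (simp_all add: coeff_shift_0)
  show "shift_map (shift_map u j) i = [((i + j) choose j)] \<cdot>\<^bsub>R\<^esub> shift_map u (i + j)"
    if "u \<in> carrier R" for u i j
    using that by (intro realize_eqI) (simp_all add: realize_nat shift_iterate)
qed

lemma coset_base_in_kx: "surfR_coset n h [:[:q:]:] \<in> kx"
proof (induction q)
  case 0
  have "surfR_coset n h [:[:0:]:] = \<zero>\<^bsub>R\<^esub>"
    by (intro realize_eqI) (simp_all add: coset_closed realize_coset)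
  then show ?case using R.simple_extension.zero by simp
next
  case (pCons c q)
  have "surfR_coset n h [:[:pCons c q:]:] =
      surfR_coset n h [:[:q:]:] \<otimes>\<^bsub>R\<^esub> surfR_x n h \<oplus>\<^bsub>R\<^esub> surfR_const n h c"
  proof (rule realize_eqI)
    have "pCons c q = q * [:0, 1:] + [:c:]" by simp
    then have "base (pCons c q) = base q * xx + base [:c:]" unfolding xx_def by (metis base_simps(3,4))
    then show "realize (surfR_coset n h [:[:pCons c q:]:]) =
        realize (surfR_coset n h [:[:q:]:] \<otimes>\<^bsub>R\<^esub> surfR_x n h \<oplus>\<^bsub>R\<^esub> surfR_const n h c)"
      by (simp add: coset_closed x_closed const_closed realize_coset realize_x realize_const)
  qed (simp_all add: coset_closed x_closed const_closed)
  then show ?case using R.simple_extension.lin[OF pCons.IH, of "surfR_const n h c"] by simp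
qed

lemma AK_subset_kx: "AK ring_of_type_algebra R (surfR_const n h) \<subseteq> kx"
proof
  fix u assume "u \<in> AK ring_of_type_algebra R (surfR_const n h)"
  then have "u \<in> exp_invariants R shift_map"
    unfolding AK_def using shift_map_exponential by blast
  moreover have "\<And>v. v \<in> carrier R \<Longrightarrow> shift_map v 0 = v"
    using exponential_map_surfD(3)[OF shift_map_exponential] .
  ultimately have u: "u \<in> carrier R" "\<And>i. i > 0 \<Longrightarrow> shift_map u i = \<zero>\<^bsub>R\<^esub>"
    using exp_invariants_iff[of shift_map] by auto
  have vanish: "poly.coeff (shift (realize u)) i = 0" if "i > 0" for i
    using u(2)[OF that] realize_shift_map(1)[OF u(1), of i] by simp
  have deg: "degree (realize u) = 0"
  proof (cases "realize u = 0")
    case False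
    then have "shift (realize u) \<noteq> 0" "degree (shift (realize u)) = degree (realize u)"
      using degree_shift by auto
    then show ?thesis using vanish[of "degree (realize u)"] by (metis leading_coeff_0_iff gr0I)
  qed simp
  obtain q where q: "realize u = base q"
  proof (cases "realize u = 0")
    case True
    then show thesis using that[of 0] by simp
  next
    case False
    from realize_in_A[OF u(1)] False obtain q b e where "degree (realize u) = 2 * b + e"
      "realize u = base q * yy ^ b * zz ^ e \<or> degree (realize u - base q * yy ^ b * zz ^ e) < degree (realize u)"
      by (rule leading_term)
    then show thesis using deg that[of q] by simp
  qed
  have "u = surfR_coset n h [:[:q:]:]"
    using u(1) by (intro realize_eqI) (simp_all add: coset_closed realize_coset q)
  then show "u \<in> kx" using coset_base_in_kx by simp
qed

end

theorem corollary3p2: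
  fixes n :: nat and h :: "'k::field poly"
  assumes "n \<ge> 2"
    and "poly h 0 \<noteq> 0"
    and "degree h < n"
  shows "AK ring_of_type_algebra (surfR n h) (surfR_const n h) =
    ring.simple_extension (surfR n h) (range (surfR_const n h)) (surfR_x n h)"
proof (rule equalityI)
  interpret danielewski n h .
  show "AK ring_of_type_algebra (surfR n h) (surfR_const n h) \<subseteq>
      ring.simple_extension (surfR n h) (range (surfR_const n h)) (surfR_x n h)"
    by (rule AK_subset_kx)
  show "ring.simple_extension (surfR n h) (range (surfR_const n h)) (surfR_x n h) \<subseteq>
      AK ring_of_type_algebra (surfR n h) (surfR_const n h)"
    using assms(1) by (rule kx_subset_AK)
qed

end
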